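(* Let $d\geq 2$ and $k\geq 0$ be integers, let $n=(d+1)((d+2)k+2)+1$, and let $m_0,\ldots,m_k$ be invertible elements of $\mathbb{Z}_n$. Let $G = G(d,k;m_0,\ldots,m_k)$ and let $\mathcal{D}=\{(\sigma_i,\tau_i): 1\leq i\leq k\}$ be a $k$-deck of permutations of $\{0,1,\ldots,d\}$ such that: (i) $\operatorname{sp}(\mathcal{D}) = \mathbb{Z}_n$; (ii) $\tau_{i}(t)+\sigma_{i-1}(t)\geq 1$ for $2\leq i\leq k$, $0\leq t\leq d-1$; (iii) $\sigma_{i}(d)\geq 1$ and $\tau_{i}(d) \geq 1$ for $1\leq i\leq k$. Then $\mathcal{K}(G,\mathcal{D}T)$ is a neighbourly member of $\overline{\mathcal{K}}(d+1)$, where $\mathcal{D}T = \{\mathcal{D}T_j: 0\leq j\leq n-1\}$.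
   Context: Let $d,k,n,m_0,\dots,m_k$ be as in the claim; all arithmetic in the arguments of vertices is in $\mathbb{Z}_n$. Graph. $G(d,k;m_0,\ldots,m_k)$ is the simple graph with vertices $v_r(\ell)$, $0\le r\le (d+1)k$, $\ell\in\mathbb{Z}_n$ (so $n((d+1)k+1)$ vertices), whose edges are exactly the edges of the orbit cycles $C_i$, i.e. $\langle v_{(d+1)i}(\ell), v_{(d+1)i}(\ell+m_i)\rangle$ for $0\le i\le k$, $\ell\in\mathbb{Z}_n$, and the edges of the radial paths $P_\ell$, i.e. $\langle v_r(\ell),v_{r+1}(\ell)\rangle$ for $0\le r<(d+1)k$, $\ell\in\mathbb{Z}_n$. Decks and subgraphs. A $k$-deck of permutations is a collection $\mathcal{D}=\{(\sigma_i,\tau_i):1\le i\le k\}$ where $\sigma_i,\tau_i$ are permutations of $\{0,1,\dots,d\}$. For $j\in\mathbb{Z}_n$, $\mathcal{D}T_j$ is the subgraph of $G(d,k;m_0,\ldots,m_k)$ induced on the union of the vertex sets of the following paths: (1) orbit paths: $v_{(d+1)i}(j+\ell m_i)$, $0\le \ell\le d+1$, for each $0\le i\le k$; (2) the radial path: $v_r(j)$, $0\le r\le (d+1)k$; (3) outward paths: $v_{(d+1)i+s}(j+\ell m_i)$, $0\le s\le \tau_{i+1}(\ell-1)$, for each $0\le i\le k-1$ and $1\le \ell\le d+1$; (4) inward paths: $v_{(d+1)i-s}(j+\ell m_i)$, $0\le s\le\sigma_i(\ell-1)$, for each $1\le i\le k$ and $1\le\ell\le d+1$. Span. $\operatorname{sp}(\mathcal{D})=\bigcup_{i=1}^k\operatorname{sp}(\sigma_i,\tau_i)\cup\{\pm\ell\,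 m_j\in\mathbb{Z}_n:0\le\ell\le d+1,\ 0\le j\le k\}$, where $\operatorname{sp}(\sigma_i,\tau_i)=\{\pm((q+1)m_{i-1}-(p+1)m_i)\in\mathbb{Z}_n:0\le p,q\le d,\ \sigma_i(p)+\tau_i(q)\ge d+1\}$. Complex. $\mathcal{K}(G,\mathcal{D}T)$ is the pure simplicial complex with facets $\hat u=\{j\in\mathbb{Z}_n: u\in \mathcal{D}T_j\}$, $u\in V(G)$. A simplicial complex is neighbourly if any two of its vertices form an edge. A triangulated $d$-ball is stacked if all its interior faces (faces not in the boundary) have dimension at least $d-1$. $\overline{\mathcal{K}}(d+1)$ is the class of all simplicial complexes all of whose vertex links are stacked $d$-balls. *)

theory Defs
  imports
    "HOL-Analysis.Analysis"
    "HOL-Number_Theory.Residues"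
    "HOL-Combinatorics.Permutations"
begin

section \<open>Simplicial complexes\<close>

text \<open>Complexes are abstract, and the empty face (of dimension \<open>-1\<close>) belongs to every complex.\<close>

definition simplicial_complex :: "'a set set \<Rightarrow> bool" where
  "simplicial_complex K \<longleftrightarrow>
     {} \<in> K \<and> (\<forall>f\<in>K. finite f) \<and> (\<forall>f\<in>K. \<forall>g. g \<subseteq> f \<longrightarrow> g \<in> K)"

definition face_dim :: "'a set \<Rightarrow> int" where
  "face_dim f = int (card f) - 1"

definition vertices :: "'a set set \<Rightarrow> 'a set" where
  "vertices K = {v. {v} \<in> K}"

definition facets :: "'a set set \<Rightarrow> 'a set set" where
  "facets K = {f \<in> K. \<forall>g\<in>K. f \<subseteq> g \<longrightarrow> g = f}"

definition pure :: "'a set set \<Rightarrow> bool" where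
  "pure K \<longleftrightarrow> (\<forall>f\<in>facets K. \<forall>g\<in>facets K. face_dim f = face_dim g)"

definition link :: "'a set set \<Rightarrow> 'a \<Rightarrow> 'a set set" where
  "link K v = {f. v \<notin> f \<and> insert v f \<in> K}"

definition neighbourly :: "'a set set \<Rightarrow> bool" where
  "neighbourly K \<longleftrightarrow> (\<forall>v\<in>vertices K. \<forall>w\<in>vertices K. v \<noteq> w \<longrightarrow> {v, w} \<in> K)"

text \<open>Points of the geometric realization are given by their barycentric coordinates; for finite
  complexes the product topology induces the usual topology.\<close>

definition geometric_realization :: "'a set set \<Rightarrow> ('a \<Rightarrow> real) topology" where
  "geometric_realization K = subtopology (powertop_real UNIV)
     {x. (\<forall>v. 0 \<le> x v) \<and> {v. x v \<noteq> 0} \<in> K \<and> (\<Sum>v\<in>{v. x v \<noteq> 0}. x v) = 1}"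

definition closed_ball_space :: "nat \<Rightarrow> (nat \<Rightarrow> real) topology" where
  "closed_ball_space d = subtopology (Euclidean_space d) {x. (\<Sum>i<d. x i ^ 2) \<le> 1}"

definition triangulated_ball :: "nat \<Rightarrow> 'a set set \<Rightarrow> bool" where
  "triangulated_ball d K \<longleftrightarrow> simplicial_complex K \<and> finite K \<and>
     geometric_realization K homeomorphic_space closed_ball_space d"

text \<open>The boundary of a triangulated \<open>d\<close>-ball is the subcomplex generated by the
  \<open>(d-1)\<close>-faces that lie in exactly one \<open>d\<close>-face.\<close>

definition boundary :: "nat \<Rightarrow> 'a set set \<Rightarrow> 'a set set" where
  "boundary d K = {f. \<exists>g\<in>K. f \<subseteq> g \<and> face_dim g = int d - 1 \<and>
     (\<exists>!h. h \<in> K \<and> face_dim h = int d \<and> g \<subseteq> h)}"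

definition stacked_ball :: "nat \<Rightarrow> 'a set set \<Rightarrow> bool" where
  "stacked_ball d K \<longleftrightarrow> triangulated_ball d K \<and>
     (\<forall>f\<in>K. f \<notin> boundary d K \<longrightarrow> face_dim f \<ge> int d - 1)"

text \<open>The class usually written \<open>K\<close>-bar of \<open>D\<close>; it is only meaningful for \<open>D \<ge> 1\<close>.\<close>

definition Kbar :: "nat \<Rightarrow> 'a set set set" where
  "Kbar D = {K. simplicial_complex K \<and> (\<forall>v\<in>vertices K. stacked_ball (D - 1) (link K v))}"


section \<open>The graph\<close>

text \<open>A graph is a pair of its vertex set and its set of (two-element) edges. The ring of
  integers modulo \<open>n\<close> is \<^term>\<open>residue_ring (int n)\<close>, so its elements are the integers
  \<open>0, \<dots>, n - 1\<close>.\<close>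

type_synonym 'v graph = "'v set \<times> 'v set set"

definition verts :: "'v graph \<Rightarrow> 'v set" where
  "verts G = fst G"

definition edges :: "'v graph \<Rightarrow> 'v set set" where
  "edges G = snd G"

definition induced_subgraph :: "'v graph \<Rightarrow> 'v set \<Rightarrow> 'v graph" where
  "induced_subgraph G W = (verts G \<inter> W, {e \<in> edges G. e \<subseteq> W})"

abbreviation Zmod :: "nat \<Rightarrow> int set" where
  "Zmod n \<equiv> carrier (residue_ring (int n))"

definition vtx :: "nat \<Rightarrow> nat \<Rightarrow> int \<Rightarrow> nat \<times> int" where
  "vtx n r x = (r, x mod int n)"

definition orbit_cycle_edges :: "nat \<Rightarrow> nat \<Rightarrow> (nat \<Rightarrow> int) \<Rightarrow> nat \<Rightarrow> (nat \<times> int) set set" where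
  "orbit_cycle_edges n d m i =
     {{vtx n ((d+1)*i) l, vtx n ((d+1)*i) (l + m i)} | l. l \<in> Zmod n}"

definition radial_path_edges :: "nat \<Rightarrow> nat \<Rightarrow> nat \<Rightarrow> int \<Rightarrow> (nat \<times> int) set set" where
  "radial_path_edges n d k l = {{vtx n r l, vtx n (r+1) l} | r. r < (d+1)*k}"

definition graphG :: "nat \<Rightarrow> nat \<Rightarrow> nat \<Rightarrow> (nat \<Rightarrow> int) \<Rightarrow> (nat \<times> int) graph" where
  "graphG n d k m =
     ({vtx n r l | r l. r \<le> (d+1)*k \<and> l \<in> Zmod n},
      (\<Union>i\<in>{0..k}. orbit_cycle_edges n d m i) \<union> (\<Union>l\<in>Zmod n. radial_path_edges n d k l))"


section \<open>Decks of permutations\<close>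

text \<open>A deck is a pair of families of permutations, indexed by \<open>1, \<dots>, k\<close>; the values of the
  families at other indices are irrelevant.\<close>

definition deck :: "nat \<Rightarrow> nat \<Rightarrow> (nat \<Rightarrow> nat \<Rightarrow> nat) \<Rightarrow> (nat \<Rightarrow> nat \<Rightarrow> nat) \<Rightarrow> bool" where
  "deck d k \<sigma> \<tau> \<longleftrightarrow> (\<forall>i\<in>{1..k}. \<sigma> i permutes {0..d} \<and> \<tau> i permutes {0..d})"

definition orbit_path_verts ::
  "nat \<Rightarrow> nat \<Rightarrow> (nat \<Rightarrow> int) \<Rightarrow> int \<Rightarrow> nat \<Rightarrow> (nat \<times> int) set" where
  "orbit_path_verts n d m j i = {vtx n ((d+1)*i) (j + int l * m i) | l. l \<le> d+1}"

definition radial_path_verts :: "nat \<Rightarrow> nat \<Rightarrow> nat \<Rightarrow> int \<Rightarrow> (nat \<times> int) set" where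
  "radial_path_verts n d k j = {vtx n r j | r. r \<le> (d+1)*k}"

definition outward_path_verts ::
  "nat \<Rightarrow> nat \<Rightarrow> (nat \<Rightarrow> int) \<Rightarrow> (nat \<Rightarrow> nat \<Rightarrow> nat) \<Rightarrow> int \<Rightarrow> nat \<Rightarrow> nat \<Rightarrow> (nat \<times> int) set" where
  "outward_path_verts n d m \<tau> j i l =
     {vtx n ((d+1)*i + s) (j + int l * m i) | s. s \<le> \<tau> (i+1) (l-1)}"

definition inward_path_verts ::
  "nat \<Rightarrow> nat \<Rightarrow> (nat \<Rightarrow> int) \<Rightarrow> (nat \<Rightarrow> nat \<Rightarrow> nat) \<Rightarrow> int \<Rightarrow> nat \<Rightarrow> nat \<Rightarrow> (nat \<times> int) set" where
  "inward_path_verts n d m \<sigma> j i l =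
     {vtx n ((d+1)*i - s) (j + int l * m i) | s. s \<le> \<sigma> i (l-1)}"

definition deck_subgraph ::
  "nat \<Rightarrow> nat \<Rightarrow> nat \<Rightarrow> (nat \<Rightarrow> int) \<Rightarrow> (nat \<Rightarrow> nat \<Rightarrow> nat) \<Rightarrow> (nat \<Rightarrow> nat \<Rightarrow> nat) \<Rightarrow> int
     \<Rightarrow> (nat \<times> int) graph" where
  "deck_subgraph n d k m \<sigma> \<tau> j = induced_subgraph (graphG n d k m)
     ((\<Union>i\<in>{0..k}. orbit_path_verts n d m j i)
      \<union> radial_path_verts n d k j
      \<union> (\<Union>i\<in>{..<k}. \<Union>l\<in>{1..d+1}. outward_path_verts n d m \<tau> j i l)
      \<union> (\<Union>i\<in>{1..k}. \<Union>l\<in>{1..d+1}. inward_path_verts n d m \<sigma> j i l))"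

definition plus_minus :: "nat \<Rightarrow> int \<Rightarrow> int set" where
  "plus_minus n x = {x mod int n, (- x) mod int n}"

definition pair_span ::
  "nat \<Rightarrow> nat \<Rightarrow> (nat \<Rightarrow> int) \<Rightarrow> (nat \<Rightarrow> nat \<Rightarrow> nat) \<Rightarrow> (nat \<Rightarrow> nat \<Rightarrow> nat) \<Rightarrow> nat \<Rightarrow> int set" where
  "pair_span n d m \<sigma> \<tau> i =
     \<Union> {plus_minus n (int (q+1) * m (i-1) - int (p+1) * m i) | p q.
          p \<le> d \<and> q \<le> d \<and> \<sigma> i p + \<tau> i q \<ge> d+1}"

definition deck_span ::
  "nat \<Rightarrow> nat \<Rightarrow> nat \<Rightarrow> (nat \<Rightarrow> int) \<Rightarrow> (nat \<Rightarrow> nat \<Rightarrow> nat) \<Rightarrow> (nat \<Rightarrow> nat \<Rightarrow> nat) \<Rightarrow> int set" where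
  "deck_span n d k m \<sigma> \<tau> =
     (\<Union>i\<in>{1..k}. pair_span n d m \<sigma> \<tau> i)
     \<union> \<Union> {plus_minus n (int l * m j) | l j. l \<le> d+1 \<and> j \<le> k}"


section \<open>The complex of a family of subgraphs\<close>

definition hat :: "'j set \<Rightarrow> ('j \<Rightarrow> 'v graph) \<Rightarrow> 'v \<Rightarrow> 'j set" where
  "hat J T u = {j \<in> J. u \<in> verts (T j)}"

text \<open>The complex generated by the sets \<^term>\<open>hat J T u\<close>; that these are exactly its facets, and
  that it is pure, depends on the family.\<close>

definition graph_complex :: "'v graph \<Rightarrow> 'j set \<Rightarrow> ('j \<Rightarrow> 'v graph) \<Rightarrow> 'j set set" where
  "graph_complex G J T = {f. \<exists>u\<in>verts G. f \<subseteq> hat J T u}"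

end

theory Submission
  imports Defs
begin

text \<open>Counting representations, the span condition says that the elements listed in the span are pairwise
  distinct, so every nonzero difference in the ring of integers modulo \<open>n\<close> is represented exactly once.
  The hat of \<open>(r, x)\<close> is \<open>x - offs r\<close>, where the offsets of row \<open>r\<close> are \<open>0\<close> and the multiples
  \<open>l * m i\<close> whose inward and outward paths reach row \<open>r\<close>; there are \<open>d + 2\<close> of them, and unique
  differences make the complex neighbourly. They also imply that two hats sharing \<open>d + 1\<close> elements
  belong to adjacent vertices of the graph, which has no triangles, so no three hats share
  \<open>d + 1\<close> elements.

  The facets in the link of \<open>j\<close> are indexed by the connected graph \<open>DT j\<close>, each sharing a ridge with
  an earlier one and hence adding at most one new vertex. Since the link has as many vertices as
  facets plus \<open>d\<close>, each facet adds exactly one. So the link arises from a simplex by gluing simplices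
  along boundary ridges, each time with a new apex, and such a gluing preserves the homeomorphism type.\<close>

section \<open>Gluing a simplex to a complex\<close>

text \<open>The value of \<open>n\<close> enters twice. It is 1 + 2((k+1)(d+1) + k d(d+1)/2), the
  largest number of residues that the span can list, so a span that covers all residues lists each
  of them once. It is also (d+2)((d+1)k+1) + d + 1, and this identity is the count of vertices
  against facets in a link. Uniqueness of differences controls two hats in different columns. It
  says nothing about two hats in the same column, since equal offsets match trivially there.
  Conditions (ii) and (iii) deal with that case: together they forbid a label that lives in an inner
  orbit row only, and therefore two rows at distance at least two differ in at least two labels.
  Condition (iii) is used once more, in different columns, to force both rows to be the orbit row of
  the common multiple. The bound d >= 2 makes 3 at most d + 1, so that \<open>3 * m i\<close> is
  covered by uniqueness; this is what excludes triangles inside an orbit cycle.\<close>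

lemma homeomorphic_space_top_of_setI:
  assumes "continuous_on S f" "continuous_on T g"
    and "\<And>x. x \<in> S \<Longrightarrow> f x \<in> T" "\<And>y. y \<in> T \<Longrightarrow> g y \<in> S"
    and "\<And>x. x \<in> S \<Longrightarrow> g (f x) = x" "\<And>y. y \<in> T \<Longrightarrow> f (g y) = y"
  shows "top_of_set S homeomorphic_space top_of_set T"
  unfolding homeomorphic_space_def homeomorphic_maps_def
  by (rule exI[of _ f], rule exI[of _ g])
    (use assms in \<open>auto simp: continuous_map_in_subtopology\<close>)

lemma continuous_on_Min:
  fixes f :: "'i \<Rightarrow> 'a::topological_space \<Rightarrow> real"
  assumes "finite I" "I \<noteq> {}" "\<And>i. i \<in> I \<Longrightarrow> continuous_on S (f i)"
  shows "continuous_on S (\<lambda>x. Min ((\<lambda>i. f i x) ` I))"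
  using assms
  by (induction rule: finite_ne_induct) (auto intro!: continuous_on_min)

lemma continuous_on_coordinate: "continuous_on S (\<lambda>x. x i)"
  by (rule continuous_on_subset[OF continuous_on_product_coordinates]) auto

definition realization_set :: "'a set set \<Rightarrow> ('a \<Rightarrow> real) set" where
  "realization_set K =
     {x. (\<forall>v. 0 \<le> x v) \<and> {v. x v \<noteq> 0} \<in> K \<and> (\<Sum>v\<in>{v. x v \<noteq> 0}. x v) = 1}"

text \<open>The product topology is the euclidean topology of the function type, so homeomorphisms
  can be given by maps that are \<open>continuous_on\<close> a set.\<close>

lemma geometric_realization_eq: "geometric_realization K = top_of_set (realization_set K)"
  unfolding geometric_realization_def realization_set_def euclidean_product_topology ..

lemma sum_support:
  fixes x :: "'a \<Rightarrow> real"
  assumes "finite S" "\<And>v. v \<notin> S \<Longrightarrow> x v = 0"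
  shows "(\<Sum>v\<in>{v. x v \<noteq> 0}. x v) = sum x S"
  by (rule sum.mono_neutral_left) (use assms in auto)

lemma realization_setI:
  assumes "finite S" "\<And>v. v \<notin> S \<Longrightarrow> x v = 0" "\<And>v. 0 \<le> x v" "{v. x v \<noteq> 0} \<in> K" "sum x S = 1"
  shows "x \<in> realization_set K"
  using assms sum_support[of S x] by (auto simp: realization_set_def)

text \<open>The two simplices over \<open>F\<close> form the join of the boundary of \<open>F\<close> with the path from \<open>w\<close> through
  the barycentre of \<open>F\<close> to \<open>v\<close>. The homeomorphism \<open>\<phi>\<close> maps this path piecewise linearly onto its half
  between \<open>w\<close> and the barycentre, whose weight is \<open>D * c x\<close>; where \<open>c x = 0\<close> and \<open>x v = 0\<close> it is the
  identity, so it extends over the rest of \<open>K\<close>.\<close>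

lemma geometric_realization_glue_simplex:
  fixes K :: "'a set set"
  assumes K: "simplicial_complex K"
    and F: "finite F" "F \<noteq> {}" and w: "w \<notin> F" "insert w F \<in> K"
    and only: "\<And>g. g \<in> K \<Longrightarrow> F \<subseteq> g \<Longrightarrow> g \<subseteq> insert w F"
    and v: "v \<notin> \<Union>K"
  shows "geometric_realization (K \<union> Pow (insert v F)) homeomorphic_space geometric_realization K"
proof -
  define D where "D = real (card F)"
  \<comment> \<open>Subtracting the common minimum on \<open>F\<close> leaves a point with a
    vanishing coordinate on \<open>F\<close>, a point over the boundary of \<open>F\<close>. So
    \<open>c x\<close> is the join coordinate that measures the barycentre's share.\<close>
  define c where "c = (\<lambda>x::'a \<Rightarrow> real. Min (x ` F))"
  define \<phi> where "\<phi> = (\<lambda>x u. if u = v then 0 else if u = w then x w + D * c x / 2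
    else if u \<in> F then x u - c x / 2 + x v / D else x u)"
  \<comment> \<open>The midpoint of the half path is \<open>y w = D * c y\<close>, the image of the
    barycentre. The balanced part of the two weights goes back to the barycentre, and the excess
    goes to \<open>w\<close> or to \<open>v\<close>, according to its side.\<close>
  define \<psi> where "\<psi> = (\<lambda>y u. if u = v then max (D * c y - y w) 0 else if u = w then max (y w - D * c y) 0
    else if u \<in> F then y u - c y + 2 * min (y w / D) (c y) else y u)"
  have D: "D > 0" using F by (simp add: D_def card_gt_0_iff)
  have D_min: "D * min (a / D) b = min a (D * b)" for a b
    using D by (simp add: min_mult_distrib_left)
  have vS: "v \<notin> insert w F" "v \<noteq> w" "v \<notin> F" using v w by auto
  have cle: "c x \<le> x u" if "u \<in> F" for x u using F that by (simp add: c_def)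
  have c0: "c x = 0" if "u \<in> F" "x u = 0" "\<And>u. 0 \<le> x u" for x u
    unfolding c_def
  proof (rule Min_eqI)
    show "0 \<in> x ` F" using that by (metis image_eqI)
  qed (use F that in auto)
  have cpos: "c x \<ge> 0" if "\<And>u. 0 \<le> x u" for x
    using F that by (simp add: c_def)
  \<comment> \<open>Both maps change all coordinates on \<open>F\<close> by the same amount, so the
    minimum moves by that amount; this computes \<open>c\<close> after either map.\<close>
  have c_shift: "c z = c x + t" if "\<And>u. u \<in> F \<Longrightarrow> z u = x u + t" for x z t
  proof -
    have "z ` F = (\<lambda>r. r + t) ` x ` F"
      using that by (auto simp: image_image)
    moreover have "Min ((\<lambda>r. r + t) ` x ` F) = Min (x ` F) + t"
      using F by (subst mono_Min_commute[symmetric, where f = "\<lambda>r. r + t"]) (auto simp: mono_def)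
    ultimately show ?thesis by (simp add: c_def)
  qed
  have c\<phi>: "c (\<phi> x) = c x / 2 + x v / D" for x
  proof -
    have "c (\<phi> x) = c x + (x v / D - c x / 2)"
      by (rule c_shift) (use vS w in \<open>auto simp: \<phi>_def\<close>)
    then show ?thesis by simp
  qed
  have c\<psi>: "c (\<psi> y) = 2 * min (y w / D) (c y)" for y
  proof -
    have "c (\<psi> y) = c y + (2 * min (y w / D) (c y) - c y)"
      by (rule c_shift) (use vS w in \<open>auto simp: \<psi>_def\<close>)
    then show ?thesis by simp
  qed
  have cont_c: "continuous_on S c" for S
    unfolding c_def by (rule continuous_on_Min) (use F in \<open>auto intro: continuous_on_coordinate\<close>)
  have cont\<phi>: "continuous_on S \<phi>" for S
    unfolding \<phi>_def
    apply (rule continuous_on_coordinatewise_then_product)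
    subgoal for i
      using D by (cases "i = v"; cases "i = w"; cases "i \<in> F")
        (auto intro!: continuous_intros cont_c continuous_on_coordinate)
    done
  have cont\<psi>: "continuous_on S \<psi>" for S
    unfolding \<psi>_def
    apply (rule continuous_on_coordinatewise_then_product)
    subgoal for i
      using D by (cases "i = v"; cases "i = w"; cases "i \<in> F")
        (auto intro!: continuous_intros cont_c continuous_on_coordinate)
    done
  have sub: "g \<in> K" if "g \<subseteq> f" "f \<in> K" for f g
    using K that by (auto simp: simplicial_complex_def)
  have sumS: "sum h (insert v (insert w F)) = h v + h w + sum h F" for h :: "'a \<Rightarrow> real"
    using vS w F by simp
  have supp: "{u. x u \<noteq> 0} \<subseteq> insert v F \<or> x v = 0 \<and> {u. x u \<noteq> 0} \<in> K"
    if "x \<in> realization_set (K \<union> Pow (insert v F))" for x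
    using that v by (auto simp: realization_set_def)
  \<comment> \<open>\<open>v\<close> is new and \<open>insert v F\<close> omits \<open>w\<close>, so
    no face contains both: a point lies on one half of the path only.\<close>
  have prod0: "min (x w) (x v) = 0" "x w = 0 \<or> x v = 0" if "x \<in> realization_set (K \<union> Pow (insert v F))" for x
  proof -
    have "x w \<ge> 0" "x v \<ge> 0" using that by (auto simp: realization_set_def)
    moreover show "x w = 0 \<or> x v = 0" using supp[OF that] w vS by blast
    ultimately show "min (x w) (x v) = 0" by (auto simp: min_def)
  qed
  have \<phi>_id: "\<phi> x = x" if "c x = 0" "x v = 0" for x
    using that by (auto simp: \<phi>_def)
  have \<psi>_id: "\<psi> x = x" if "c x = 0" "x v = 0" "x w \<ge> 0" for x
    using that D by (auto simp: \<psi>_def)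
  have \<phi>_in: "\<phi> x \<in> realization_set K" if x: "x \<in> realization_set (K \<union> Pow (insert v F))" for x
  proof -
    have nn: "\<And>u. 0 \<le> x u" and s1: "(\<Sum>v\<in>{v. x v \<noteq> 0}. x v) = 1"
      using x by (auto simp: realization_set_def)
    show ?thesis
    proof (cases "{u. x u \<noteq> 0} \<subseteq> insert v (insert w F)")
      case True
      have "(\<Sum>v\<in>{v. x v \<noteq> 0}. x v) = sum x (insert v (insert w F))"
        by (rule sum_support) (use F True in auto)
      then have "sum x (insert v (insert w F)) = 1" using s1 by metis
      then have sx: "x v + x w + sum x F = 1" unfolding sumS .
      show ?thesis
      proof (rule realization_setI[of "insert v (insert w F)"])
        show "finite (insert v (insert w F))" using F by simp
        show z: "\<phi> x u = 0" if "u \<notin> insert v (insert w F)" for u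
          using that True by (auto simp: \<phi>_def)
        show "0 \<le> \<phi> x u" for u
          using D cle[of u x] cpos[OF nn] nn[of u] nn[of v] nn[of w] by (auto simp: \<phi>_def intro!: add_nonneg_nonneg)
        have "\<phi> x v = 0" by (simp add: \<phi>_def)
        moreover have "u \<in> insert v (insert w F)" if "\<phi> x u \<noteq> 0" for u
          using z[of u] that by blast
        ultimately have "{u. \<phi> x u \<noteq> 0} \<subseteq> insert w F" by auto
        then show "{u. \<phi> x u \<noteq> 0} \<in> K" using sub[OF _ w(2)] by blast
        have "sum (\<phi> x) F = sum (\<lambda>u. x u - c x / 2 + x v / D) F"
          using vS w by (intro sum.cong) (auto simp: \<phi>_def)
        also have "\<dots> = sum x F - D * c x / 2 + x v"
          using D by (simp add: sum.distrib sum_subtractf D_def)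
        finally show "sum (\<phi> x) (insert v (insert w F)) = 1"
          unfolding sumS using sx vS by (simp add: \<phi>_def)
      qed
    next
      case False
      then have *: "x v = 0" "{u. x u \<noteq> 0} \<in> K" using supp[OF x] by auto
      then have "\<not> F \<subseteq> {u. x u \<noteq> 0}" using only[of "{u. x u \<noteq> 0}"] False by blast
      then obtain u where "u \<in> F" "x u = 0" by blast
      then have "c x = 0" using nn by (rule c0)
      then show ?thesis using \<phi>_id * nn s1 by (simp add: realization_set_def)
    qed
  qed
  have \<psi>_in: "\<psi> y \<in> realization_set (K \<union> Pow (insert v F))" if y: "y \<in> realization_set K" for y
  proof -
    have nn: "\<And>u. 0 \<le> y u" and s1: "(\<Sum>v\<in>{v. y v \<noteq> 0}. y v) = 1" and yK: "{u. y u \<noteq> 0} \<in> K"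
      using y by (auto simp: realization_set_def)
    have yv: "y v = 0" using yK v by auto
    show ?thesis
    proof (cases "{u. y u \<noteq> 0} \<subseteq> insert w F")
      case True
      have "(\<Sum>v\<in>{v. y v \<noteq> 0}. y v) = sum y (insert v (insert w F))"
        by (rule sum_support) (use F True in auto)
      then have "sum y (insert v (insert w F)) = 1" using s1 by metis
      then have sx: "y w + sum y F = 1" unfolding sumS yv by simp
      show ?thesis
      proof (rule realization_setI[of "insert v (insert w F)"])
        show "finite (insert v (insert w F))" using F by simp
        show z: "\<psi> y u = 0" if "u \<notin> insert v (insert w F)" for u
          using that True by (auto simp: \<psi>_def)
        have min0: "min (y w / D) (c y) \<ge> 0" using D nn[of w] cpos[OF nn] by simp
        show "0 \<le> \<psi> y u" for u
        proof -
          have "u \<in> F \<Longrightarrow> 0 \<le> y u - c y + 2 * min (y w / D) (c y)"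
            using cle[of u y] min0 by linarith
          then show ?thesis using nn[of u] unfolding \<psi>_def by (simp split del: if_split split: if_split)
        qed
        have zS: "u \<in> insert v (insert w F)" if "\<psi> y u \<noteq> 0" for u
          using z[of u] that by blast
        have "{u. \<psi> y u \<noteq> 0} \<subseteq> insert w F \<or> {u. \<psi> y u \<noteq> 0} \<subseteq> insert v F"
        proof (cases "y w \<ge> D * c y")
          case True
          then have "\<psi> y v = 0" by (simp add: \<psi>_def)
          then show ?thesis using zS by auto
        next
          case False
          then have "\<psi> y w = 0" using vS by (simp add: \<psi>_def)
          then show ?thesis using zS by auto
        qed
        then show "{u. \<psi> y u \<noteq> 0} \<in> K \<union> Pow (insert v F)" using sub[OF _ w(2)] by blast
        have "sum (\<psi> y) F = sum (\<lambda>u. y u - c y + 2 * min (y w / D) (c y)) F"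
          using vS w by (intro sum.cong) (auto simp: \<psi>_def)
        also have "\<dots> = sum y F - D * c y + 2 * (D * min (y w / D) (c y))"
          by (simp add: sum.distrib sum_subtractf D_def)
        also note D_min
        finally have sF: "sum (\<psi> y) F = sum y F - D * c y + 2 * min (y w) (D * c y)" .
        have "\<psi> y v = max (D * c y - y w) 0" "\<psi> y w = max (y w - D * c y) 0"
          using vS by (simp_all add: \<psi>_def)
        then show "sum (\<psi> y) (insert v (insert w F)) = 1"
          unfolding sumS sF using sx by linarith
      qed
    next
      case False
      then have "\<not> F \<subseteq> {u. y u \<noteq> 0}" using only[of "{u. y u \<noteq> 0}"] yK by blast
      then obtain u where "u \<in> F" "y u = 0" by blast
      then have "c y = 0" using nn by (rule c0)
      then show ?thesis using \<psi>_id yv yK nn s1 by (simp add: realization_set_def)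
    qed
  qed
  have \<psi>\<phi>: "\<psi> (\<phi> x) = x" if x: "x \<in> realization_set (K \<union> Pow (insert v F))" for x
  proof
    fix u
    have nn: "0 \<le> x w" "0 \<le> x v" using x by (auto simp: realization_set_def)
    have 1: "D * (c x / 2 + x v / D) = D * c x / 2 + x v" using D by (simp add: field_simps)
    have 2: "(x w + D * c x / 2) / D = x w / D + c x / 2" using D by (simp add: field_simps)
    have 3: "min (x w / D + c x / 2) (c x / 2 + x v / D) = c x / 2"
      using prod0(2)[OF x] nn D by (auto simp: min_def divide_le_0_iff)
    show "\<psi> (\<phi> x) u = x u"
      unfolding \<psi>_def c\<phi>
      using prod0[OF x] nn vS w 3 by (auto simp: \<phi>_def 1 2)
  qed
  have \<phi>\<psi>: "\<phi> (\<psi> y) = y" if y: "y \<in> realization_set K" for y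
  proof
    fix u
    have yv: "y v = 0" using y v by (auto simp: realization_set_def)
    have \<psi>v: "\<psi> y v = max (D * c y - y w) 0" and \<psi>w: "\<psi> y w = max (y w - D * c y) 0"
      using vS by (simp_all add: \<psi>_def)
    consider "u = v" | "u = w" | "u \<in> F" "u \<noteq> v" "u \<noteq> w" | "u \<notin> F" "u \<noteq> v" "u \<noteq> w"
      by blast
    then show "\<phi> (\<psi> y) u = y u"
    proof cases
      case 1
      then show ?thesis by (simp add: \<phi>_def yv)
    next
      case 2
      then have "\<phi> (\<psi> y) u = max (y w - D * c y) 0 + min (y w) (D * c y)"
        using vS by (simp add: \<phi>_def \<psi>w c\<psi> D_min)
      then show ?thesis using 2 by (simp add: min_def max_def)
    next
      case 3
      then have "\<phi> (\<psi> y) u = y u - c y + min (y w / D) (c y) + max (D * c y - y w) 0 / D"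
        by (simp add: \<phi>_def c\<psi> \<psi>v) (simp add: \<psi>_def)
      moreover have "max (D * c y - y w) 0 / D = max (c y - y w / D) 0"
        using D by (simp add: max_divide_distrib_right diff_divide_distrib)
      ultimately show ?thesis by (simp add: min_def max_def)
    next
      case 4
      then show ?thesis by (simp add: \<phi>_def \<psi>_def)
    qed
  qed
  show ?thesis
    unfolding geometric_realization_eq
    by (rule homeomorphic_space_top_of_setI[OF cont\<phi> cont\<psi>])
      (erule \<phi>_in \<psi>_in \<psi>\<phi> \<phi>\<psi>)+
qed

section \<open>The realization of a simplex\<close>

text \<open>Continuity is in doubt only where \<open>q z = 0\<close>. There the factor is 0 by the
  convention on division, and since \<open>q\<close> dominates every coordinate, each coordinate of
  the image is bounded by \<open>\<bar>p z\<bar>\<close>, which tends to 0.\<close>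

lemma continuous_on_radial:
  fixes p q :: "('i \<Rightarrow> real) \<Rightarrow> real"
  assumes "continuous_on S p" "continuous_on S q"
    and q0: "\<And>z. z \<in> S \<Longrightarrow> q z = 0 \<Longrightarrow> p z = 0"
    and q: "\<And>z i. z \<in> S \<Longrightarrow> \<bar>z i\<bar> \<le> q z"
  shows "continuous_on S (\<lambda>z i. p z / q z * z i)"
proof (rule continuous_on_coordinatewise_then_product)
  fix i
  have bound: "\<bar>p z / q z * z i\<bar> \<le> \<bar>p z\<bar>" if "z \<in> S" for z
  proof (cases "q z = 0")
    case False
    then have "\<bar>p z\<bar> * \<bar>z i\<bar> / \<bar>q z\<bar> \<le> \<bar>p z\<bar> * \<bar>q z\<bar> / \<bar>q z\<bar>"
      using q[OF that, of i] by (intro divide_right_mono mult_left_mono) auto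
    then show ?thesis using False by (simp add: abs_mult)
  qed simp
  show "continuous_on S (\<lambda>z. p z / q z * z i)"
    unfolding continuous_on_def
  proof
    fix z assume z: "z \<in> S"
    have p: "(p \<longlongrightarrow> p z) (at z within S)" and qq: "(q \<longlongrightarrow> q z) (at z within S)"
      using assms(1,2) z by (auto simp: continuous_on_def)
    have zi: "((\<lambda>z. z i) \<longlongrightarrow> z i) (at z within S)"
      using continuous_on_coordinate[of S i] z by (auto simp: continuous_on_def)
    show "((\<lambda>z. p z / q z * z i) \<longlongrightarrow> p z / q z * z i) (at z within S)"
    proof (cases "q z = 0")
      case True
      have "((\<lambda>z. p z / q z * z i) \<longlongrightarrow> 0) (at z within S)"
      proof (rule tendsto_0_le[where K = 1])
        show "(p \<longlongrightarrow> 0) (at z within S)" using p q0[OF z True] by simp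
        show "\<forall>\<^sub>F z in at z within S. norm (p z / q z * z i) \<le> norm (p z) * 1"
          unfolding eventually_at_filter using bound by (intro always_eventually) auto
      qed
      then show ?thesis using True by simp
    qed (use p qq zi in \<open>auto intro!: tendsto_intros\<close>)
  qed
qed

text \<open>Each ray is stretched by \<open>p z / q z\<close>, with inverse factor
  \<open>q z / p z\<close>. Positive homogeneity suffices; \<open>p\<close> and \<open>q\<close>
  need not be norms, which matters because the gauge of a simplex is not symmetric.\<close>

lemma homeomorphic_gauge_balls:
  fixes p q :: "('i \<Rightarrow> real) \<Rightarrow> real"
  assumes cont: "continuous_on S p" "continuous_on S q"
    and scale: "\<And>a z. z \<in> S \<Longrightarrow> 0 \<le> a \<Longrightarrow> (\<lambda>i. a * z i) \<in> S"
    and p_scale: "\<And>a z. 0 \<le> a \<Longrightarrow> p (\<lambda>i. a * z i) = a * p z"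
    and q_scale: "\<And>a z. 0 \<le> a \<Longrightarrow> q (\<lambda>i. a * z i) = a * q z"
    and p: "\<And>z i. z \<in> S \<Longrightarrow> \<bar>z i\<bar> \<le> p z" and q: "\<And>z i. z \<in> S \<Longrightarrow> \<bar>z i\<bar> \<le> q z"
  shows "top_of_set {z \<in> S. p z \<le> 1} homeomorphic_space top_of_set {z \<in> S. q z \<le> 1}"
proof -
  \<comment> \<open>The local \<open>p\<close> and \<open>q\<close> shadow the outer ones, so that
    the facts also apply with the roles exchanged.\<close>
  have key: "q z = 0 \<Longrightarrow> p z = 0"
    "(\<lambda>i. p z / q z * z i) \<in> S"
    "q (\<lambda>i. p z / q z * z i) = p z"
    "(\<lambda>i. q (\<lambda>i. p z / q z * z i) / p (\<lambda>i. p z / q z * z i) * (p z / q z * z i)) = z"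
    if z: "z \<in> S" and q: "\<And>z i. z \<in> S \<Longrightarrow> \<bar>z i\<bar> \<le> q z" and p: "\<And>z i. z \<in> S \<Longrightarrow> \<bar>z i\<bar> \<le> p z"
      and p_scale: "\<And>a z. 0 \<le> a \<Longrightarrow> p (\<lambda>i. a * z i) = a * p z"
      and q_scale: "\<And>a z. 0 \<le> a \<Longrightarrow> q (\<lambda>i. a * z i) = a * q z"
    for z and p q :: "('i \<Rightarrow> real) \<Rightarrow> real"
  proof -
    have nn: "0 \<le> p z" "0 \<le> q z"
      using p[OF z] q[OF z] by (meson abs_ge_zero order_trans)+
    have z0: "z = (\<lambda>i. 0)" if "q z = 0 \<or> p z = 0"
      using that p[OF z] q[OF z] by fastforce
    have p0: "p (\<lambda>i. 0) = 0" and q0: "q (\<lambda>i. 0) = 0"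
      using p_scale[of 0 z] q_scale[of 0 z] by simp_all
    show qp: "q z = 0 \<Longrightarrow> p z = 0" using z0 p0 by metis
    show "(\<lambda>i. p z / q z * z i) \<in> S" by (rule scale) (use z nn in auto)
    have qs: "q (\<lambda>i. p z / q z * z i) = p z / q z * q z" "p (\<lambda>i. p z / q z * z i) = p z / q z * p z"
      by (rule q_scale p_scale, use nn in simp)+
    show "q (\<lambda>i. p z / q z * z i) = p z" unfolding qs using qp by simp
    show "(\<lambda>i. q (\<lambda>i. p z / q z * z i) / p (\<lambda>i. p z / q z * z i) * (p z / q z * z i)) = z"
    proof (cases "q z = 0 \<or> p z = 0")
      case True
      then have "z = (\<lambda>i. 0)" by (rule z0)
      then show ?thesis by simp
    next
      case False
      then show ?thesis unfolding qs by (auto simp: field_simps)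
    qed
  qed
  show ?thesis
  proof (rule homeomorphic_space_top_of_setI)
    show "continuous_on {z \<in> S. p z \<le> 1} (\<lambda>z i. p z / q z * z i)"
      by (rule continuous_on_radial)
        (use cont key(1)[OF _ p q q_scale p_scale] key(1)[OF _ q p p_scale q_scale] q in
          \<open>auto intro: continuous_on_subset\<close>)
    show "continuous_on {z \<in> S. q z \<le> 1} (\<lambda>z i. q z / p z * z i)"
      by (rule continuous_on_radial)
        (use cont key(1)[OF _ p q q_scale p_scale] key(1)[OF _ q p p_scale q_scale] p in
          \<open>auto intro: continuous_on_subset\<close>)
  next
    fix z assume z: "z \<in> {z \<in> S. p z \<le> 1}"
    then show "(\<lambda>i. p z / q z * z i) \<in> {z \<in> S. q z \<le> 1}"
      using key(2,3)[OF _ q p p_scale q_scale] by simp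
    show "(\<lambda>i. q (\<lambda>i. p z / q z * z i) / p (\<lambda>i. p z / q z * z i) * (p z / q z * z i)) = z"
      using key(4)[OF _ q p p_scale q_scale] z by simp
  next
    fix z assume z: "z \<in> {z \<in> S. q z \<le> 1}"
    then show "(\<lambda>i. q z / p z * z i) \<in> {z \<in> S. p z \<le> 1}"
      using key(2,3)[OF _ p q q_scale p_scale] by simp
    show "(\<lambda>i. p (\<lambda>i. q z / p z * z i) / q (\<lambda>i. q z / p z * z i) * (q z / p z * z i)) = z"
      using key(4)[OF _ p q q_scale p_scale] z by simp
  qed
qed

lemma closed_ball_space_eq:
  "closed_ball_space d = top_of_set {z \<in> {z. \<forall>i\<ge>d. z i = 0}. sqrt (\<Sum>i<d. z i ^ 2) \<le> 1}"
  unfolding closed_ball_space_def Euclidean_space_def euclidean_product_topology subtopology_subtopology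
  by (rule arg_cong[where f = "subtopology euclidean"]) auto

text \<open>Adjoin \<open>- (\<Sum>i<d. z i)\<close> as a last entry: these are d + 1 numbers with
  sum zero, none below \<open>- M\<close>, so none exceeds \<open>d * M\<close>.\<close>

lemma abs_le_if_sum_zero:
  fixes z :: "nat \<Rightarrow> real"
  assumes "0 \<le> M" "i < d" "\<And>i. i < d \<Longrightarrow> - z i \<le> M" "(\<Sum>i<d. z i) \<le> M"
  shows "\<bar>z i\<bar> \<le> real (Suc d) * M"
proof -
  have "- z i + (\<Sum>i<d. z i) = (\<Sum>j\<in>{..<d} - {i}. z j)"
    using assms(2) by (simp add: sum_diff1)
  moreover have "(\<Sum>j\<in>{..<d} - {i}. - z j) \<le> (\<Sum>j\<in>{..<d} - {i}. M)"
    by (rule sum_mono) (use assms in auto)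
  moreover have "(\<Sum>j\<in>{..<d} - {i}. M) = (real d - 1) * M"
    using assms(2) by (simp add: of_nat_diff)
  ultimately have "z i \<le> real d * M"
    using assms(4) by (simp add: sum_negf algebra_simps)
  moreover have "0 \<le> real d * M" using assms(1) by simp
  moreover have "- z i \<le> M" using assms by blast
  moreover have "real (Suc d) * M = M + real d * M" by (simp add: algebra_simps)
  ultimately show ?thesis using assms(1) by linarith
qed

lemma continuous_on_Max:
  fixes f :: "'i \<Rightarrow> 'a::topological_space \<Rightarrow> real"
  assumes "finite I" "I \<noteq> {}" "\<And>i. i \<in> I \<Longrightarrow> continuous_on S (f i)"
  shows "continuous_on S (\<lambda>x. Max ((\<lambda>i. f i x) ` I))"
  using assms
  by (induction rule: finite_ne_induct) (auto intro!: continuous_on_max)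

text \<open>Moving the barycentre to the origin and dropping one barycentric coordinate turns the
  simplex into the unit ball of a gauge \<open>p\<close>, which is then compared with the Euclidean
  norm \<open>q\<close>.\<close>

lemma geometric_realization_simplex:
  fixes S :: "'a set"
  assumes S: "finite S" "card S = Suc d"
  shows "geometric_realization (Pow S) homeomorphic_space closed_ball_space d"
proof -
  define E :: "(nat \<Rightarrow> real) set" where "E = {z. \<forall>i\<ge>d. z i = 0}"
  define N where "N = real (Suc d)"
  \<comment> \<open>The barycentric coordinates are \<open>1 / N + z i\<close>, and
    \<open>1 / N - (\<Sum>i<d. z i)\<close> for the dropped one, which index \<open>d\<close> stands
    for. All of them are nonnegative exactly when \<open>p z \<le> 1\<close>.\<close>
  define p where "p = (\<lambda>z. N * Max ((\<lambda>i. if i < d then - z i else \<Sum>i<d. z i) ` {..d}))"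
  define q where "q = (\<lambda>z::nat \<Rightarrow> real. sqrt (\<Sum>i<d. z i ^ 2))"
  have N: "N > 0" by (simp add: N_def)
  have p_le: "p z \<le> a \<longleftrightarrow> (\<Sum>i<d. z i) \<le> a / N \<and> (\<forall>i<d. - z i \<le> a / N)" for z a
  proof -
    have "p z \<le> a \<longleftrightarrow> Max ((\<lambda>i. if i < d then - z i else \<Sum>i<d. z i) ` {..d}) \<le> a / N"
      unfolding p_def using N by (simp only: pos_le_divide_eq mult.commute)
    also have "\<dots> \<longleftrightarrow> (\<forall>i\<le>d. (if i < d then - z i else \<Sum>i<d. z i) \<le> a / N)"
      by (subst Max_le_iff) auto
    also have "\<dots> \<longleftrightarrow> (\<Sum>i<d. z i) \<le> a / N \<and> (\<forall>i<d. - z i \<le> a / N)"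
      by (auto simp: le_eq_less_or_eq)
    finally show ?thesis .
  qed
  have p_scale: "p (\<lambda>i. a * z i) = a * p z" if "0 \<le> a" for a z
  proof -
    have "(\<lambda>i. if i < d then - (a * z i) else \<Sum>i<d. a * z i) ` {..d}
        = (*) a ` (\<lambda>i. if i < d then - z i else \<Sum>i<d. z i) ` {..d}"
      unfolding image_image by (rule image_cong) (auto simp: sum_distrib_left)
    then have "Max ((\<lambda>i. if i < d then - (a * z i) else \<Sum>i<d. a * z i) ` {..d})
        = a * Max ((\<lambda>i. if i < d then - z i else \<Sum>i<d. z i) ` {..d})"
      using that by (subst mono_Max_commute[where f = "(*) a"]) (auto simp: mono_def mult_left_mono)
    then show ?thesis by (simp add: p_def)
  qed
  have p_nn: "0 \<le> p z" for z
  proof (rule ccontr)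
    assume "\<not> 0 \<le> p z"
    then have "(\<Sum>i<d. z i) \<le> p z / N" "\<And>i. i < d \<Longrightarrow> - z i \<le> p z / N" "p z / N < 0"
      using p_le[of z "p z"] N by (auto simp: divide_less_0_iff)
    moreover have "(\<Sum>i<d. z i) \<ge> 0"
      by (rule sum_nonneg) (use calculation in fastforce)
    ultimately show False by linarith
  qed
  have p_abs: "\<bar>z i\<bar> \<le> p z" if "z \<in> E" for z i
  proof (cases "i < d")
    case True
    have "\<bar>z i\<bar> \<le> real (Suc d) * (p z / N)"
      by (rule abs_le_if_sum_zero) (use True p_nn[of z] p_le[of z "p z"] N in auto)
    then show ?thesis using N by (simp add: N_def)
  qed (use that p_nn in \<open>auto simp: E_def\<close>)
  have q_scale: "q (\<lambda>i. a * z i) = a * q z" if "0 \<le> a" for a z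
    using that by (simp add: q_def power_mult_distrib real_sqrt_mult flip: sum_distrib_left)
  have q_abs: "\<bar>z i\<bar> \<le> q z" if "z \<in> E" for z i
  proof (cases "i < d")
    case True
    have "(z i)\<^sup>2 \<le> (\<Sum>i<d. z i ^ 2)" by (rule member_le_sum) (use True in auto)
    then show ?thesis using real_sqrt_le_mono by (fastforce simp: q_def)
  qed (use that in \<open>auto simp: E_def q_def sum_nonneg\<close>)
  have cont_p: "continuous_on A p" for A
  proof -
    have "continuous_on A (\<lambda>z. if i < d then - z i else \<Sum>i<d. z i)" for i
      by (cases "i < d") (auto intro!: continuous_intros continuous_on_coordinate)
    then show ?thesis
      unfolding p_def by (intro continuous_on_mult continuous_on_const continuous_on_Max) auto
  qed
  have cont_q: "continuous_on A q" for A
    unfolding q_def by (intro continuous_intros continuous_on_coordinate)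
  have gauge: "top_of_set {z \<in> E. p z \<le> 1} homeomorphic_space top_of_set {z \<in> E. q z \<le> 1}"
    by (rule homeomorphic_gauge_balls[OF cont_p cont_q _ p_scale q_scale p_abs q_abs]) (auto simp: E_def)
  obtain e where e: "bij_betw e {..d} S"
    using S by (metis card_atMost finite_atMost finite_same_card_bij)
  define e' where "e' = the_inv_into {..d} e"
  have e': "e' u \<le> d" "e (e' u) = u" if "u \<in> S" for u
    using that e f_the_inv_into_f_bij_betw[OF e] the_inv_into_into[of e "{..d}" u "{..d}"]
    by (auto simp: e'_def bij_betw_def)
  have e'e: "e' (e i) = i" "e i \<in> S" if "i \<le> d" for i
    using that e by (auto simp: e'_def bij_betw_def the_inv_into_f_f)
  define f where "f = (\<lambda>x::'a \<Rightarrow> real. \<lambda>i. if i < d then x (e i) - 1 / N else 0)"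
  define g where "g = (\<lambda>z::nat \<Rightarrow> real. \<lambda>u. if u \<notin> S then 0 else if e' u < d then z (e' u) + 1 / N
    else 1 / N - (\<Sum>i<d. z i))"
  have sumS: "sum x S = (\<Sum>i<d. x (e i)) + x (e d)" for x :: "'a \<Rightarrow> real"
    using sum.reindex_bij_betw[OF e, of x] by (simp add: lessThan_Suc flip: lessThan_Suc_atMost)
  have real: "realization_set (Pow S) = {x. (\<forall>v. 0 \<le> x v) \<and> (\<forall>v. v \<notin> S \<longrightarrow> x v = 0) \<and> sum x S = 1}"
  proof -
    have "x \<in> realization_set (Pow S) \<longleftrightarrow> (\<forall>v. 0 \<le> x v) \<and> (\<forall>v. v \<notin> S \<longrightarrow> x v = 0) \<and> sum x S = 1" for x
    proof (cases "\<forall>v. v \<notin> S \<longrightarrow> x v = 0")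
      case True
      then have "(\<Sum>v\<in>{v. x v \<noteq> 0}. x v) = sum x S" by (intro sum_support S(1)) blast
      moreover have "{v. x v \<noteq> 0} \<in> Pow S" using True by blast
      ultimately show ?thesis using True unfolding realization_set_def by simp
    next
      case False
      then show ?thesis by (auto simp: realization_set_def)
    qed
    then show ?thesis by blast
  qed
  have sumf: "(\<Sum>i<d. f x i) = 1 / N - x (e d)" if "sum x S = 1" for x
  proof -
    have "(\<Sum>i<d. f x i) = (\<Sum>i<d. x (e i)) - real d / N" by (simp add: f_def sum_subtractf)
    moreover have "real d / N = 1 - 1 / N" using N by (simp add: N_def field_simps)
    ultimately show ?thesis using that unfolding sumS by linarith
  qed
  have "top_of_set (realization_set (Pow S)) homeomorphic_space top_of_set {z \<in> E. p z \<le> 1}"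
  proof (rule homeomorphic_space_top_of_setI)
    show "continuous_on (realization_set (Pow S)) f"
      unfolding f_def
      apply (rule continuous_on_coordinatewise_then_product)
      subgoal for i
        by (cases "i < d") (auto intro!: continuous_intros continuous_on_coordinate)
      done
    show "continuous_on {z \<in> E. p z \<le> 1} g"
      unfolding g_def
      apply (rule continuous_on_coordinatewise_then_product)
      subgoal for u
        by (cases "u \<in> S"; cases "e' u < d") (auto intro!: continuous_intros continuous_on_coordinate)
      done
  next
    fix x assume "x \<in> realization_set (Pow S)"
    then have x: "\<And>v. 0 \<le> x v" "\<And>v. v \<notin> S \<Longrightarrow> x v = 0" "sum x S = 1" by (auto simp: real)
    show "f x \<in> {z \<in> E. p z \<le> 1}"
      using x(1) by (auto simp: E_def p_le sumf[OF x(3)]) (auto simp: f_def)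
    show "g (f x) = x"
    proof
      fix u
      show "g (f x) u = x u"
      proof (cases "u \<in> S")
        case True
        have "e d = u" if "\<not> e' u < d"
          using e'[OF True] that by (metis le_neq_implies_less)
        then show ?thesis
          using True e'[OF True] unfolding g_def sumf[OF x(3)] by (auto simp: f_def)
      qed (simp add: g_def x(2))
    qed
  next
    fix z assume z: "z \<in> {z \<in> E. p z \<le> 1}"
    then have z': "(\<Sum>i<d. z i) \<le> 1 / N" "\<And>i. i < d \<Longrightarrow> - z i \<le> 1 / N" "\<And>i. i \<ge> d \<Longrightarrow> z i = 0"
      by (auto simp: p_le E_def)
    have ge: "g z (e i) = z i + 1 / N" if "i < d" for i
      using that e'e[of i] by (simp add: g_def)
    have gd: "g z (e d) = 1 / N - (\<Sum>i<d. z i)"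
      using e'e[of d] by (simp add: g_def)
    have "0 \<le> g z u" for u
    proof (cases "u \<in> S \<and> e' u < d")
      case True
      then show ?thesis using z'(2)[of "e' u"] by (simp add: g_def)
    qed (use z'(1) in \<open>auto simp: g_def\<close>)
    moreover have "sum (g z) S = 1"
    proof -
      have "sum (g z) S = real d / N + 1 / N"
        by (simp add: sumS ge gd sum.distrib)
      then show ?thesis using N by (simp add: N_def field_simps)
    qed
    ultimately show "g z \<in> realization_set (Pow S)" by (simp add: real) (simp add: g_def)
    show "f (g z) = z"
      using ge z'(3) by (fastforce simp: f_def)
  qed
  also note gauge
  finally show ?thesis
    unfolding geometric_realization_eq closed_ball_space_eq E_def q_def .
qed

section \<open>Stacked complexes\<close>

text \<open>A purely combinatorial form of stackedness. The condition on \<open>g\<close> says that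
  \<open>F\<close> is a boundary ridge, lying under the single facet \<open>insert w F\<close>; it
  is the hypothesis of the gluing lemma, and the new apex \<open>v\<close> keeps all other faces
  untouched.\<close>

inductive stacked_complex :: "nat \<Rightarrow> 'a set set \<Rightarrow> bool" for d where
  simplex: "finite S \<Longrightarrow> card S = Suc d \<Longrightarrow> stacked_complex d (Pow S)"
| glue: "stacked_complex d K \<Longrightarrow> finite F \<Longrightarrow> card F = d \<Longrightarrow> w \<notin> F \<Longrightarrow> insert w F \<in> K \<Longrightarrow>
    (\<And>g. g \<in> K \<Longrightarrow> F \<subseteq> g \<Longrightarrow> g \<subseteq> insert w F) \<Longrightarrow> v \<notin> \<Union>K \<Longrightarrow>
    stacked_complex d (K \<union> Pow (insert v F))"

lemma stacked_complex_triangulated_ball: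
  assumes "stacked_complex d K" "d \<ge> 1"
  shows "triangulated_ball d K"
  using assms(1)
proof induction
  case (simplex S)
  then show ?case
    using geometric_realization_simplex[of S d]
    by (auto simp: triangulated_ball_def simplicial_complex_def intro: finite_subset)
next
  case (glue K F w v)
  then have K: "simplicial_complex K" "finite K"
    "geometric_realization K homeomorphic_space closed_ball_space d"
    by (auto simp: triangulated_ball_def)
  \<comment> \<open>This needs \<open>d \<ge> 1\<close>: gluing a point to a point along the empty
    face would give two isolated points.\<close>
  have "F \<noteq> {}" using glue.hyps assms(2) by auto
  then have "geometric_realization (K \<union> Pow (insert v F)) homeomorphic_space closed_ball_space d"
    using geometric_realization_glue_simplex[OF K(1) \<open>finite F\<close> _ \<open>w \<notin> F\<close> \<open>insert w F \<in> K\<close> _ \<open>v \<notin> \<Union>K\<close>]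
      glue.hyps K(3) homeomorphic_space_trans by blast
  moreover have "simplicial_complex (K \<union> Pow (insert v F))"
    using K(1) \<open>finite F\<close> unfolding simplicial_complex_def
    by (metis UnE UnI1 UnI2 PowD PowI finite_insert finite_subset order_trans)
  ultimately show ?case using K(2) \<open>finite F\<close> by (simp add: triangulated_ball_def)
qed

lemma mem_boundary_iff:
  "f \<in> boundary d K \<longleftrightarrow>
    (\<exists>g\<in>K. f \<subseteq> g \<and> card g = d \<and> (\<exists>!h. h \<in> K \<and> card h = Suc d \<and> g \<subseteq> h))"
proof -
  have "int (card h) - 1 = int d \<longleftrightarrow> card h = Suc d" "int (card g) - 1 = int d - 1 \<longleftrightarrow> card g = d"
    for g h :: "'a set" by linarith+
  then show ?thesis by (simp add: boundary_def face_dim_def)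
qed

text \<open>A small face of the new simplex misses some \<open>x\<close> in \<open>F\<close>, so it
  lies in the ridge \<open>insert v (F - {x})\<close>, which only the new simplex contains. An old
  face keeps its old boundary ridge \<open>g\<close>, unless \<open>g\<close> is the ridge
  \<open>F\<close> that was glued; then the face lies in the new simplex as well.\<close>

lemma stacked_complex_small_faces_boundary:
  assumes "stacked_complex d K" "f \<in> K" "card f < d"
  shows "f \<in> boundary d K"
  using assms
proof (induction arbitrary: f)
  case (simplex S)
  then have "f \<noteq> S" "f \<subseteq> S" by auto
  then obtain x where x: "x \<in> S" "x \<notin> f" by blast
  have "h = S" if "h \<subseteq> S" "card h = Suc d" for h
    using that simplex card_subset_eq by metis
  then have "\<exists>!h. h \<in> Pow S \<and> card h = Suc d \<and> S - {x} \<subseteq> h"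
    using simplex by (intro ex1I[of _ S]) auto
  then show ?case
    unfolding mem_boundary_iff using x \<open>f \<subseteq> S\<close> simplex.hyps
    by (intro bexI[of _ "S - {x}"]) auto
next
  case (glue K F w v)
  have v: "v \<notin> g" if "g \<in> K" for g using that glue.hyps by blast
  have vF: "v \<notin> F" using v[of "insert w F"] glue.hyps by blast
  have cv: "card (insert v F) = Suc d" using vF glue.hyps by simp
  have new: "h = insert v F" if "h \<subseteq> insert v F" "card h = Suc d" for h
    using that glue.hyps cv by (metis card_subset_eq finite_insert)
  have side: ?case if "f \<subseteq> insert v F"
  proof -
    have "\<not> F \<subseteq> f"
    proof
      assume "F \<subseteq> f"
      then have "card F \<le> card f"
        using that glue.hyps by (meson card_mono finite_insert finite_subset)
      then show False using glue by simp
    qed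
    then obtain x where x: "x \<in> F" "x \<notin> f" by blast
    have "card (insert v (F - {x})) = d"
      using x(1) vF glue.hyps(2,3) by (metis Diff_iff card_Suc_Diff1 card_insert_disjoint finite_Diff)
    moreover have "\<exists>!h. h \<in> K \<union> Pow (insert v F) \<and> card h = Suc d \<and> insert v (F - {x}) \<subseteq> h"
      using cv new v by (intro ex1I[of _ "insert v F"]) auto
    moreover have "f \<subseteq> insert v (F - {x})" using that x by auto
    ultimately show ?case
      unfolding mem_boundary_iff by (intro bexI[of _ "insert v (F - {x})"]) auto
  qed
  show ?case
  proof (cases "f \<in> K")
    case True
    then have "f \<in> boundary d K" using glue by blast
    then obtain g h where gh: "g \<in> K" "f \<subseteq> g" "card g = d" "h \<in> K" "card h = Suc d" "g \<subseteq> h"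
      and uniq: "\<And>h'. h' \<in> K \<Longrightarrow> card h' = Suc d \<Longrightarrow> g \<subseteq> h' \<Longrightarrow> h' = h"
      unfolding mem_boundary_iff by metis
    show ?thesis
    proof (cases "g \<subseteq> F")
      case True
      then show ?thesis using gh side by blast
    next
      case False
      then have "\<not> g \<subseteq> insert v F" using v[OF gh(1)] by blast
      then have "\<exists>!h. h \<in> K \<union> Pow (insert v F) \<and> card h = Suc d \<and> g \<subseteq> h"
      proof (intro ex1I[of _ h] conjI)
        fix h' assume h': "h' \<in> K \<union> Pow (insert v F) \<and> card h' = Suc d \<and> g \<subseteq> h'"
        then have "h' \<in> K" using \<open>\<not> g \<subseteq> insert v F\<close> by blast
        then show "h' = h" using h' uniq by blast
      qed (use gh in auto)
      then show ?thesis
        unfolding mem_boundary_iff using gh(1-3) by (intro bexI[of _ g] conjI UnI1)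
    qed
  qed (use glue.prems side in auto)
qed

lemma stacked_complex_stacked_ball:
  assumes "stacked_complex d K" "d \<ge> 1"
  shows "stacked_ball d K"
  unfolding stacked_ball_def face_dim_def
proof (intro conjI ballI impI)
  show "triangulated_ball d K" by (rule stacked_complex_triangulated_ball[OF assms])
  fix f assume "f \<in> K" "f \<notin> boundary d K"
  then have "\<not> card f < d" using stacked_complex_small_faces_boundary[OF assms(1)] by blast
  then show "int d - 1 \<le> int (card f) - 1" by simp
qed

text \<open>The assumption \<open>big\<close> leaves no slack in the vertex count, and
  \<open>ridge\<close> says that a ridge between two facets lies in no third one, which makes it a
  boundary ridge of whatever was built before the second of them is added.\<close>

lemma stacked_complex_connected_family:
  fixes h :: "'u \<Rightarrow> 'a set"
  assumes V: "finite V" "u\<^sub>0 \<in> V"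
    and h: "\<And>u. u \<in> V \<Longrightarrow> finite (h u)" "\<And>u. u \<in> V \<Longrightarrow> card (h u) = Suc d"
    and conn: "\<And>u. u \<in> V \<Longrightarrow> (u\<^sub>0, u) \<in> {(u, v). u \<in> V \<and> v \<in> V \<and> d \<le> card (h u \<inter> h v)}\<^sup>*"
    and big: "card V + d \<le> card (\<Union>(h ` V))"
    and ridge: "\<And>u v w. \<lbrakk>u \<in> V; v \<in> V; w \<in> V; u \<noteq> v; v \<noteq> w; u \<noteq> w\<rbrakk> \<Longrightarrow> card (h u \<inter> h v \<inter> h w) < d"
  shows "stacked_complex d {f. \<exists>u\<in>V. f \<subseteq> h u}"
proof -
  \<comment> \<open>Stackedness is guarded by equality because equality is known only for the whole
    of \<open>V\<close>. A step adds at most one vertex, so equality at one stage forces it at the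
    preceding one.\<close>
  have grow: "\<exists>U\<subseteq>V. u\<^sub>0 \<in> U \<and> card U = Suc m \<and> card (\<Union>(h ` U)) \<le> Suc m + d \<and>
      (card (\<Union>(h ` U)) = Suc m + d \<longrightarrow> stacked_complex d {f. \<exists>u\<in>U. f \<subseteq> h u})"
    if "m < card V" for m
    using that
  proof (induction m)
    case 0
    have "{f. \<exists>u\<in>{u\<^sub>0}. f \<subseteq> h u} = Pow (h u\<^sub>0)" by auto
    then have "stacked_complex d {f. \<exists>u\<in>{u\<^sub>0}. f \<subseteq> h u}"
      using stacked_complex.simplex[of "h u\<^sub>0" d] V h by simp
    then show ?case using V h by (intro exI[of _ "{u\<^sub>0}"]) auto
  next
    case (Suc m)
    then obtain U where U: "U \<subseteq> V" "u\<^sub>0 \<in> U" "card U = Suc m" "card (\<Union>(h ` U)) \<le> Suc m + d"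
      and st: "card (\<Union>(h ` U)) = Suc m + d \<Longrightarrow> stacked_complex d {f. \<exists>u\<in>U. f \<subseteq> h u}"
      by auto
    have finU: "finite U" using U V finite_subset by blast
    define W where "W = \<Union>(h ` U)"
    have finW: "finite W" using finU U h by (auto simp: W_def)
    \<comment> \<open>Otherwise no path from \<open>u\<^sub>0\<close> could leave \<open>U\<close>,
      although all of \<open>V\<close> is reachable.\<close>
    have "\<exists>a b. a \<in> U \<and> b \<in> V - U \<and> d \<le> card (h a \<inter> h b)"
    proof (rule ccontr)
      assume no: "\<not> ?thesis"
      have "u \<in> U" if "(u\<^sub>0, u) \<in> {(u, v). u \<in> V \<and> v \<in> V \<and> d \<le> card (h u \<inter> h v)}\<^sup>*" for u
        using that by induction (use U no in auto)
      then have "V \<subseteq> U" using conn by blast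
      then show False using U Suc.prems by auto
    qed
    then obtain a b where ab: "a \<in> U" "b \<in> V" "b \<notin> U" "d \<le> card (h a \<inter> h b)" by blast
    have fb: "finite (h b)" "card (h b) = Suc d" "finite (h a)" "card (h a) = Suc d"
      using h ab U by auto
    have "card (h b - W) \<le> card (h b - h a)"
      by (rule card_mono) (use fb ab in \<open>auto simp: W_def\<close>)
    also have "\<dots> \<le> 1"
      using card_Diff_subset_Int[of "h b" "h a"] fb ab(4) by (simp add: Int_commute)
    finally have le1: "card (h b - W) \<le> 1" .
    have WU: "\<Union>(h ` insert b U) = W \<union> (h b - W)" by (auto simp: W_def)
    have cardW: "card (\<Union>(h ` insert b U)) = card W + card (h b - W)"
      unfolding WU by (rule card_Un_disjoint) (use finW fb in auto)
    have "stacked_complex d {f. \<exists>u\<in>insert b U. f \<subseteq> h u}"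
      if eq: "card (\<Union>(h ` insert b U)) = Suc (Suc m) + d"
    proof -
      have 1: "card (h b - W) = 1" "card W = Suc m + d"
        using eq cardW le1 U(4) unfolding W_def by linarith+
      then obtain v where v: "h b - W = {v}" using card_1_singletonE by blast
      have vW: "v \<notin> W" "v \<in> h b" using v by blast+
      define F where "F = h b - {v}"
      have F: "finite F" "card F = d" "insert v F = h b"
        using vW fb by (auto simp: F_def)
      have "h a \<inter> h b \<subseteq> F" using vW ab by (auto simp: F_def W_def)
      \<comment> \<open>The d common elements are old, and only d elements of \<open>h b\<close> are
        old, so they are all of \<open>F\<close>.\<close>
      then have Fab: "h a \<inter> h b = F" using ab(4) F by (metis card_seteq)
      then have "card (h a - F) = 1" using fb F card_Diff_subset[of F "h a"] by auto
      then obtain w where w: "h a - F = {w}" using card_1_singletonE by blast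
      then have w': "w \<notin> F" "insert w F = h a" using Fab by blast+
      have "stacked_complex d ({f. \<exists>u\<in>U. f \<subseteq> h u} \<union> Pow (insert v F))"
      proof (rule stacked_complex.glue)
        show "stacked_complex d {f. \<exists>u\<in>U. f \<subseteq> h u}" using st 1 by (simp add: W_def)
        show "insert w F \<in> {f. \<exists>u\<in>U. f \<subseteq> h u}" using w' ab by blast
        show "v \<notin> \<Union>{f. \<exists>u\<in>U. f \<subseteq> h u}" using vW by (auto simp: W_def)
        fix g assume "g \<in> {f. \<exists>u\<in>U. f \<subseteq> h u}" and Fg: "F \<subseteq> g"
        then obtain u where u: "u \<in> U" "g \<subseteq> h u" by blast
        have "u = a"
        proof (rule ccontr)
          assume "u \<noteq> a"
          then have "card (h a \<inter> h b \<inter> h u) < d" by (intro ridge) (use ab u U in auto)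
          moreover have "h a \<inter> h b \<inter> h u = F" using Fab u Fg by blast
          ultimately show False using F by simp
        qed
        then show "g \<subseteq> insert w F" using u w' by simp
      qed (use F w' in auto)
      moreover have "{f. \<exists>u\<in>insert b U. f \<subseteq> h u} = {f. \<exists>u\<in>U. f \<subseteq> h u} \<union> Pow (insert v F)"
        using F by auto
      ultimately show ?thesis by simp
    qed
    moreover have "card (\<Union>(h ` insert b U)) \<le> Suc (Suc m) + d"
      using cardW le1 U(4) by (simp add: W_def)
    ultimately show ?case
      using U ab finU by (intro exI[of _ "insert b U"]) auto
  qed
  obtain m where m: "card V = Suc m"
    using V by (metis card_eq_0_iff empty_iff not0_implies_Suc)
  then have "m < card V" by simp
  from grow[OF this] obtain U where U: "U \<subseteq> V" "card U = Suc m"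
    and st: "card (\<Union>(h ` U)) \<le> Suc m + d"
      "card (\<Union>(h ` U)) = Suc m + d \<longrightarrow> stacked_complex d {f. \<exists>u\<in>U. f \<subseteq> h u}"
    by blast
  have "U = V" using U V m by (simp add: card_subset_eq)
  then show ?thesis using st m big by auto
qed

section \<open>Differences in a deck\<close>

text \<open>The permutation lists the lengths of the d + 1 paths that leave an orbit row in one
  direction; this counts those that reach distance \<open>s\<close>.\<close>

lemma card_permutes_ge:
  fixes \<pi> :: "nat \<Rightarrow> nat"
  assumes "\<pi> permutes {0..d}"
  shows "card {l \<in> {1..d+1}. s \<le> \<pi> (l - 1)} = d + 1 - s"
proof -
  have "bij_betw (\<lambda>l. \<pi> (l - 1)) {l \<in> {1..d+1}. s \<le> \<pi> (l - 1)} {s..d}"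
  proof (rule bij_betw_byWitness[where f' = "\<lambda>y. inv_into UNIV \<pi> y + 1"])
    show "\<forall>a\<in>{l \<in> {1..d+1}. s \<le> \<pi> (l - 1)}. inv_into UNIV \<pi> (\<pi> (a - 1)) + 1 = a"
      using permutes_inverses(2)[OF assms] by auto
    show "\<forall>a'\<in>{s..d}. \<pi> (inv_into UNIV \<pi> a' + 1 - 1) = a'"
      using permutes_inverses(1)[OF assms] by auto
    show "(\<lambda>l. \<pi> (l - 1)) ` {l \<in> {1..d+1}. s \<le> \<pi> (l - 1)} \<subseteq> {s..d}"
    proof (rule image_subsetI)
      fix l assume "l \<in> {l \<in> {1..d+1}. s \<le> \<pi> (l - 1)}"
      then show "\<pi> (l - 1) \<in> {s..d}" using permutes_in_image[OF assms, of "l - 1"] by auto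
    qed
    show "(\<lambda>y. inv_into UNIV \<pi> y + 1) ` {s..d} \<subseteq> {l \<in> {1..d+1}. s \<le> \<pi> (l - 1)}"
    proof (rule image_subsetI)
      fix y assume "y \<in> {s..d}"
      then show "inv_into UNIV \<pi> y + 1 \<in> {l \<in> {1..d+1}. s \<le> \<pi> (l - 1)}"
        using permutes_in_image[OF permutes_inv[OF assms], of y] permutes_inverses(1)[OF assms] by auto
    qed
  qed
  then show ?thesis using bij_betw_same_card by fastforce
qed

text \<open>Each \<open>x\<close> admits exactly \<open>x\<close> values of \<open>y\<close>. This
  bounds the number of differences contributed by one pair of permutations.\<close>

lemma card_pairs_sum_large:
  "2 * card {(x, y). x \<le> d \<and> y \<le> d \<and> d + 1 \<le> x + y} = d * (d + 1)"
proof -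
  have "{(x, y). x \<le> d \<and> y \<le> d \<and> d + 1 \<le> x + y} = (SIGMA x:{0..d}. {d + 1 - x..d})"
    by auto
  then have "card {(x, y). x \<le> d \<and> y \<le> d \<and> d + 1 \<le> x + y} = (\<Sum>x=0..d. x)"
    by simp
  then show ?thesis using gauss_sum_nat[of d] by simp
qed

locale deck_family =
  fixes d k n :: nat and m :: "nat \<Rightarrow> int" and \<sigma> \<tau> :: "nat \<Rightarrow> nat \<Rightarrow> nat"
  assumes d: "d \<ge> 2"
    and n: "n = (d+1) * ((d+2) * k + 2) + 1"
    and deck: "deck d k \<sigma> \<tau>"
    and span: "deck_span n d k m \<sigma> \<tau> = Zmod n"
    and cross: "\<And>i t. 2 \<le> i \<Longrightarrow> i \<le> k \<Longrightarrow> t \<le> d - 1 \<Longrightarrow> \<tau> i t + \<sigma> (i-1) t \<ge> 1"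
    and last: "\<And>i. 1 \<le> i \<Longrightarrow> i \<le> k \<Longrightarrow> \<sigma> i d \<ge> 1 \<and> \<tau> i d \<ge> 1"
begin

abbreviation N :: int where "N \<equiv> int n"

definition ctr :: "nat \<Rightarrow> nat" where "ctr i = (d + 1) * i"

text \<open>The default 0, here and in \<open>dn\<close>, says that no outward path starts in the
  last orbit row and no inward path in the first.\<close>

definition up :: "nat \<Rightarrow> nat \<Rightarrow> nat" where
  "up i l = (if i < k then \<tau> (i + 1) (l - 1) else 0)"

definition dn :: "nat \<Rightarrow> nat \<Rightarrow> nat" where
  "dn i l = (if 1 \<le> i then \<sigma> i (l - 1) else 0)"

text \<open>A label \<open>(i, l)\<close> stands for the multiple \<open>l * m i\<close>; it belongs to the rows from \<open>ctr i - dn i l\<close> to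
  \<open>ctr i + up i l\<close>.\<close>

definition lab :: "nat \<Rightarrow> (nat \<times> nat) set" where
  "lab r = {(i, l). i \<le> k \<and> 1 \<le> l \<and> l \<le> d + 1 \<and> ctr i \<le> r + dn i l \<and> r \<le> ctr i + up i l}"

definition val :: "nat \<times> nat \<Rightarrow> int" where
  "val x = (int (snd x) * m (fst x)) mod N"

definition offs :: "nat \<Rightarrow> int set" where
  "offs r = insert 0 (val ` lab r)"

definition diff :: "(nat \<times> nat) \<times> (nat \<times> nat) \<Rightarrow> int" where
  "diff p = (val (fst p) - val (snd p)) mod N"

text \<open>The span is the set of differences of the pairs of labels in \<open>\<Omega>\<close>, where \<open>(i, 0)\<close> stands for \<open>0\<close>:
  \<open>\<Omega>\<^sub>1\<close> gives the multiples and \<open>\<Omega>\<^sub>2\<close> the spans of the pairs of permutations.\<close>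

definition \<Omega>\<^sub>1 :: "((nat \<times> nat) \<times> (nat \<times> nat)) set" where
  "\<Omega>\<^sub>1 = {((i, l), (i, 0)) | i l. i \<le> k \<and> 1 \<le> l \<and> l \<le> d + 1}"

definition \<Omega>\<^sub>2 :: "((nat \<times> nat) \<times> (nat \<times> nat)) set" where
  "\<Omega>\<^sub>2 = {((i, l), (i + 1, l')) | i l l'. i < k \<and> 1 \<le> l \<and> l \<le> d + 1 \<and> 1 \<le> l' \<and> l' \<le> d + 1 \<and>
     d + 1 \<le> \<sigma> (i + 1) (l' - 1) + \<tau> (i + 1) (l - 1)}"

definition \<Omega> :: "((nat \<times> nat) \<times> (nat \<times> nat)) set" where
  "\<Omega> = insert ((0, 0), (0, 0)) ((\<Omega>\<^sub>1 \<union> \<Omega>\<^sub>2) \<union> prod.swap ` (\<Omega>\<^sub>1 \<union> \<Omega>\<^sub>2))"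

lemma Zmod_eq: "Zmod n = {0..<N}"
  by (auto simp: residue_ring_def)

lemma n_pos: "n > 0" by (simp add: n)

lemma mod_in_Zmod [simp]: "x mod N \<in> Zmod n"
  using n_pos by (simp add: Zmod_eq)

lemma Zmod_mod: "x \<in> Zmod n \<Longrightarrow> x mod N = x"
  by (simp add: Zmod_eq)

lemma \<sigma>_permutes: "1 \<le> i \<Longrightarrow> i \<le> k \<Longrightarrow> \<sigma> i permutes {0..d}"
  and \<tau>_permutes: "1 \<le> i \<Longrightarrow> i \<le> k \<Longrightarrow> \<tau> i permutes {0..d}"
  using deck by (auto simp: deck_def)

lemma ctr_0 [simp]: "ctr 0 = 0" by (simp add: ctr_def)

lemma ctr_Suc: "ctr (Suc i) = ctr i + (d + 1)" by (simp add: ctr_def)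

lemma ctr_less: "i < j \<Longrightarrow> ctr i + (d + 1) \<le> ctr j"
  unfolding ctr_Suc[symmetric] unfolding ctr_def by (rule mult_le_mono2) simp

lemma ctr_mono: "i \<le> j \<Longrightarrow> ctr i \<le> ctr j"
  unfolding ctr_def by (rule mult_le_mono2)

lemma ctr_inj: "ctr i = ctr j \<Longrightarrow> i = j"
  using ctr_less[of i j] ctr_less[of j i] by (cases i j rule: linorder_cases) auto

lemma row_cases:
  assumes "r \<le> ctr k"
  obtains i s where "r = ctr i + s" "s \<le> d" "i < k \<or> i = k \<and> s = 0"
proof -
  define i where "i = r div (d + 1)"
  define s where "s = r mod (d + 1)"
  have r: "r = ctr i + s" unfolding ctr_def i_def s_def by (rule mult_div_mod_eq[symmetric])
  moreover have "s \<le> d" using mod_less_divisor[of "d+1" r] unfolding s_def by linarith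
  moreover have "i < k \<or> i = k \<and> s = 0"
    using ctr_less[of k i] assms r by (cases i k rule: linorder_cases) auto
  ultimately show ?thesis using that by blast
qed

lemma up_le: "1 \<le> l \<Longrightarrow> l \<le> d + 1 \<Longrightarrow> up i l \<le> d"
  using permutes_in_image[OF \<tau>_permutes[of "i+1"], of "l-1"] by (auto simp: up_def)

lemma dn_le: "1 \<le> l \<Longrightarrow> l \<le> d + 1 \<Longrightarrow> i \<le> k \<Longrightarrow> dn i l \<le> d"
  using permutes_in_image[OF \<sigma>_permutes[of "i"], of "l-1"] by (auto simp: dn_def)

lemma ctr_up_le: "1 \<le> l \<Longrightarrow> l \<le> d + 1 \<Longrightarrow> i \<le> k \<Longrightarrow> ctr i + up i l \<le> ctr k"
  using up_le[of l i] ctr_less[of i k] by (cases "i < k") (auto simp: up_def)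

lemma val_0 [simp]: "val (i, 0) = 0" by (simp add: val_def)

lemma val_in_Zmod [simp]: "val x \<in> Zmod n" unfolding val_def by simp

lemma offs_subset: "offs r \<subseteq> Zmod n"
  using mod_in_Zmod[of 0] by (auto simp: offs_def)

text \<open>There are at most (k+1)(d+1) pairs in \<open>\<Omega>\<^sub>1\<close>. For each orbit,
  the permutations inject the pairs of \<open>\<Omega>\<^sub>2\<close> into the pairs of values with
  sum at least d + 1, so there are at most k d(d+1)/2 of them. Doubling for the signs and adding the
  zero pair gives \<open>n\<close>.\<close>

lemma finite_\<Omega>: "finite \<Omega>\<^sub>1" "finite \<Omega>\<^sub>2" "finite \<Omega>"
  and card_\<Omega>: "card \<Omega> \<le> n"
proof -
  have 1: "\<Omega>\<^sub>1 = (\<lambda>(i, l). ((i, l), (i, 0))) ` ({..k} \<times> {1..d+1})"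
    by (auto simp: \<Omega>\<^sub>1_def)
  then show f1: "finite \<Omega>\<^sub>1" by simp
  have c1: "card \<Omega>\<^sub>1 \<le> (k + 1) * (d + 1)"
    unfolding 1 by (rule order_trans[OF card_image_le]) auto
  define Q where "Q i = {(l, l'). 1 \<le> l \<and> l \<le> d + 1 \<and> 1 \<le> l' \<and> l' \<le> d + 1 \<and>
     d + 1 \<le> \<sigma> (i + 1) (l' - 1) + \<tau> (i + 1) (l - 1)}" for i
  have finQ: "finite (Q i)" for i
    by (rule finite_subset[of _ "{1..d+1} \<times> {1..d+1}"]) (auto simp: Q_def)
  have cQ: "2 * card (Q i) \<le> d * (d + 1)" if "i < k" for i
  proof -
    have p: "\<sigma> (i+1) permutes {0..d}" "\<tau> (i+1) permutes {0..d}"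
      using that \<sigma>_permutes \<tau>_permutes by auto
    define f where "f = (\<lambda>(l, l'). (\<sigma> (i+1) (l' - 1), \<tau> (i+1) (l - 1)))"
    have "inj_on f (Q i)"
    proof (rule inj_onI)
      fix x y assume xy: "x \<in> Q i" "y \<in> Q i" "f x = f y"
      obtain l l' h h' where eq: "x = (l, l')" "y = (h, h')" by (meson surj_pair)
      have "l' - 1 = h' - 1" "l - 1 = h - 1"
        using xy eq permutes_inj[OF p(1)] permutes_inj[OF p(2)] by (auto simp: f_def dest: injD)
      then show "x = y" using xy eq by (auto simp: Q_def)
    qed
    moreover have "f ` Q i \<subseteq> {(x, y). x \<le> d \<and> y \<le> d \<and> d + 1 \<le> x + y}"
    proof (rule image_subsetI)
      fix z assume z: "z \<in> Q i"
      obtain l l' where "z = (l, l')" by (cases z)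
      with z show "f z \<in> {(x, y). x \<le> d \<and> y \<le> d \<and> d + 1 \<le> x + y}"
        using permutes_in_image[OF p(1), of "l' - 1"] permutes_in_image[OF p(2), of "l - 1"]
        by (auto simp: f_def Q_def)
    qed
    moreover have "finite {(x, y). x \<le> d \<and> y \<le> d \<and> d + 1 \<le> x + y}"
      by (rule finite_subset[of _ "{..d} \<times> {..d}"]) auto
    ultimately have "card (Q i) \<le> card {(x, y). x \<le> d \<and> y \<le> d \<and> d + 1 \<le> x + y}"
      by (rule card_inj_on_le)
    then show ?thesis using card_pairs_sum_large[of d] by linarith
  qed
  have 2: "\<Omega>\<^sub>2 = (\<lambda>(i, l, l'). ((i, l), (i + 1, l'))) ` (SIGMA i:{..<k}. Q i)"
    by (auto simp: \<Omega>\<^sub>2_def Q_def image_iff)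
  then show f2: "finite \<Omega>\<^sub>2" using finQ by auto
  have "card \<Omega>\<^sub>2 \<le> (\<Sum>i<k. card (Q i))"
    unfolding 2 by (rule order_trans[OF card_image_le]) (use finQ in auto)
  then have "2 * card \<Omega>\<^sub>2 \<le> (\<Sum>i<k. 2 * card (Q i))" by (simp add: sum_distrib_left[symmetric])
  also have "\<dots> \<le> (\<Sum>i<k. d * (d + 1))" by (rule sum_mono) (use cQ in auto)
  finally have c2: "2 * card \<Omega>\<^sub>2 \<le> k * (d * (d + 1))" by simp
  show "finite \<Omega>" using f1 f2 by (simp add: \<Omega>_def)
  have "card \<Omega> \<le> Suc (card (\<Omega>\<^sub>1 \<union> \<Omega>\<^sub>2) + card (prod.swap ` (\<Omega>\<^sub>1 \<union> \<Omega>\<^sub>2)))"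
    unfolding \<Omega>_def
    by (rule order_trans[OF card_insert_le_m1]) (auto intro: card_Un_le)
  also have "card (prod.swap ` (\<Omega>\<^sub>1 \<union> \<Omega>\<^sub>2)) \<le> card (\<Omega>\<^sub>1 \<union> \<Omega>\<^sub>2)"
    by (rule card_image_le) (use f1 f2 in auto)
  also have "card (\<Omega>\<^sub>1 \<union> \<Omega>\<^sub>2) \<le> card \<Omega>\<^sub>1 + card \<Omega>\<^sub>2" by (rule card_Un_le)
  finally have "card \<Omega> \<le> Suc (2 * card \<Omega>\<^sub>1 + 2 * card \<Omega>\<^sub>2)" by simp
  also have "\<dots> \<le> Suc (2 * ((k + 1) * (d + 1)) + k * (d * (d + 1)))" using c1 c2 by linarith
  also have "\<dots> = n" unfolding n by (simp add: algebra_simps)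
  finally show "card \<Omega> \<le> n" .
qed

lemma diff_eq: "diff ((i, l), (i', l')) = (int l * m i - int l' * m i') mod N"
  by (simp add: diff_def val_def mod_diff_eq)

lemma diff_swap: "diff (prod.swap p) = (- diff p) mod N"
  by (cases p) (simp add: diff_def mod_minus_eq)

lemma diff_surj: "diff ` \<Omega> = Zmod n"
proof
  show "diff ` \<Omega> \<subseteq> Zmod n" by (auto simp only: diff_def mod_in_Zmod)
  have pm: "plus_minus n x \<subseteq> diff ` \<Omega>" if "x mod N = diff p" "p \<in> \<Omega>\<^sub>1 \<union> \<Omega>\<^sub>2" for x p
  proof -
    have "(- x) mod N = (- (x mod N)) mod N" by (simp add: mod_minus_eq)
    then have "(- x) mod N = diff (prod.swap p)" using that by (simp add: diff_swap)
    moreover have "p \<in> \<Omega>" "prod.swap p \<in> \<Omega>" using that by (auto simp only: \<Omega>_def)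
    ultimately show ?thesis using that(1) unfolding plus_minus_def by blast
  qed
  have "deck_span n d k m \<sigma> \<tau> \<subseteq> diff ` \<Omega>"
  proof
    fix x assume "x \<in> deck_span n d k m \<sigma> \<tau>"
    then consider i p q where "i \<in> {1..k}" "p \<le> d" "q \<le> d" "\<sigma> i p + \<tau> i q \<ge> d+1"
        "x \<in> plus_minus n (int (q+1) * m (i-1) - int (p+1) * m i)"
      | l j where "x \<in> plus_minus n (int l * m j)" "l \<le> d+1" "j \<le> k"
      unfolding deck_span_def pair_span_def by blast
    then show "x \<in> diff ` \<Omega>"
    proof cases
      case 1
      then have "((i - 1, q + 1), (i, p + 1)) \<in> \<Omega>\<^sub>2"
        unfolding \<Omega>\<^sub>2_def by (cases i) auto
      then show ?thesis using pm[of _ "((i - 1, q + 1), (i, p + 1))"] 1(5) by (auto simp: diff_eq)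
    next
      case 2
      show ?thesis
      proof (cases "l = 0")
        case True
        then have "x = diff ((0, 0), (0, 0))" using 2(1) by (auto simp: plus_minus_def diff_eq)
        moreover have "((0, 0), (0, 0)) \<in> \<Omega>" unfolding \<Omega>_def by blast
        ultimately show ?thesis by blast
      next
        case False
        then have "((j, l), (j, 0)) \<in> \<Omega>\<^sub>1" using 2 unfolding \<Omega>\<^sub>1_def by auto
        then show ?thesis using pm[of _ "((j, l), (j, 0))"] 2(1) by (auto simp: diff_eq)
      qed
    qed
  qed
  then show "Zmod n \<subseteq> diff ` \<Omega>" using span by simp
qed

text \<open>A surjection from at most \<open>n\<close> pairs onto \<open>n\<close> residues is
  injective.\<close>

lemma inj_diff: "inj_on diff \<Omega>"
proof (rule eq_card_imp_inj_on[OF finite_\<Omega>(3)])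
  have "card (diff ` \<Omega>) = n" unfolding diff_surj Zmod_eq by simp
  then show "card (diff ` \<Omega>) = card \<Omega>"
    using card_\<Omega> card_image_le[OF finite_\<Omega>(3), of diff] by simp
qed

section \<open>Uniqueness of differences in terms of labels\<close>

lemma \<Omega>I: "p \<in> \<Omega>\<^sub>1 \<Longrightarrow> p \<in> \<Omega>" "p \<in> \<Omega>\<^sub>2 \<Longrightarrow> p \<in> \<Omega>"
  "prod.swap p \<in> \<Omega>\<^sub>1 \<Longrightarrow> p \<in> \<Omega>" "prod.swap p \<in> \<Omega>\<^sub>2 \<Longrightarrow> p \<in> \<Omega>"
  unfolding \<Omega>_def by (force simp: image_iff)+

text \<open>The representative in \<open>\<Omega>\<close> of the difference of two multiples of one
  \<open>m i\<close>: only the distance of \<open>a\<close> and \<open>b\<close> and its sign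
  survive. All zero differences share one representative, so \<open>i\<close> can be recovered only
  when \<open>a \<noteq> b\<close>.\<close>

definition step :: "nat \<Rightarrow> nat \<Rightarrow> nat \<Rightarrow> (nat \<times> nat) \<times> (nat \<times> nat)" where
  "step i a b = (if b < a then ((i, a - b), (i, 0)) else if a < b then ((i, 0), (i, b - a))
     else ((0, 0), (0, 0)))"

lemma step_in_\<Omega>: "i \<le> k \<Longrightarrow> a \<le> d + 1 \<Longrightarrow> b \<le> d + 1 \<Longrightarrow> step i a b \<in> \<Omega>"
proof -
  assume "i \<le> k" "a \<le> d + 1" "b \<le> d + 1"
  then have "b < a \<Longrightarrow> ((i, a - b), (i, 0)) \<in> \<Omega>\<^sub>1" "a < b \<Longrightarrow> prod.swap ((i, 0), (i, b - a)) \<in> \<Omega>\<^sub>1"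
    by (auto simp: \<Omega>\<^sub>1_def)
  moreover have "((0, 0), (0, 0)) \<in> \<Omega>" unfolding \<Omega>_def by blast
  ultimately show ?thesis unfolding step_def by (auto intro: \<Omega>I(1,3))
qed

lemma diff_step: "diff (step i a b) = (val (i, a) - val (i, b)) mod N"
proof -
  have "(val (i, a) - val (i, b)) mod N = ((int a - int b) * m i) mod N"
    by (simp add: val_def mod_diff_eq left_diff_distrib)
  moreover have "diff (step i a b) = ((int a - int b) * m i) mod N"
    by (auto simp: step_def diff_eq of_nat_diff algebra_simps)
  ultimately show ?thesis by simp
qed

lemma step_eqD:
  assumes "step i a b = step i' a' b'"
  shows "a \<noteq> b \<Longrightarrow> i = i'" "a + b' = a' + b"
  using assms by (auto simp: step_def split: if_splits)

text \<open>Both differences have a representative \<open>step\<close>, and injectivity identifies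
  the two. The equation of sums says that a - b = a' - b' without truncated subtraction.\<close>

lemma val_diff_unique:
  assumes "i \<le> k" "i' \<le> k" "a \<le> d + 1" "b \<le> d + 1" "a' \<le> d + 1" "b' \<le> d + 1"
    and "(val (i, a) - val (i, b)) mod N = (val (i', a') - val (i', b')) mod N"
  shows "a \<noteq> b \<Longrightarrow> i = i'" "a + b' = a' + b"
proof -
  have "step i a b = step i' a' b'"
    using inj_onD[OF inj_diff] assms diff_step step_in_\<Omega> by metis
  note eq = step_eqD[OF this]
  show "a \<noteq> b \<Longrightarrow> i = i'" by (rule eq(1))
  show "a + b' = a' + b" by (rule eq(2))
qed

lemma val_same_inj: "i \<le> k \<Longrightarrow> a \<le> d + 1 \<Longrightarrow> b \<le> d + 1 \<Longrightarrow> val (i, a) = val (i, b) \<Longrightarrow> a = b"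
  using val_diff_unique(2)[of i i a b 0 0] by simp

lemma val_inj:
  "i \<le> k \<Longrightarrow> i' \<le> k \<Longrightarrow> a \<le> d + 1 \<Longrightarrow> b \<le> d + 1 \<Longrightarrow> a \<noteq> 0 \<Longrightarrow> val (i, a) = val (i', b) \<Longrightarrow> i = i' \<and> a = b"
  using val_diff_unique[of i i' a 0 b 0] by simp

lemma val_neq_0: "i \<le> k \<Longrightarrow> a \<le> d + 1 \<Longrightarrow> a \<noteq> 0 \<Longrightarrow> val (i, a) \<noteq> 0"
  using val_same_inj[of i a 0] by auto

lemma lab_bounds: "(i, l) \<in> lab r \<Longrightarrow> i \<le> k \<and> 1 \<le> l \<and> l \<le> d + 1"
  by (simp add: lab_def)

lemma inj_on_val_lab: "inj_on val (\<Union>(range lab))"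
proof (rule inj_onI, clarify)
  fix i l i' l' r r' assume "(i, l) \<in> lab r" "(i', l') \<in> lab r'" "val (i, l) = val (i', l')"
  then show "i = i' \<and> l = l'" using val_inj[of i i' l l'] lab_bounds[of i l r] lab_bounds[of i' l' r'] by auto
qed

lemma zero_notin_val_lab: "0 \<notin> val ` lab r"
proof clarify
  fix i l assume "0 = val (i, l)" "(i, l) \<in> lab r"
  then show False using val_neq_0[of i l] lab_bounds[of i l r] by simp
qed

text \<open>A path reaches at most \<open>d\<close> rows away from its orbit row while orbit rows
  are \<open>d + 1\<close> apart, so the two orbits must be consecutive. The two paths then meet
  exactly under the inequality that defines \<open>\<Omega>\<^sub>2\<close>.\<close>

lemma lab_pair:
  assumes "(i, l) \<in> lab r" "(i', l') \<in> lab r" "i < i'"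
  shows "((i, l), (i', l')) \<in> \<Omega>\<^sub>2"
proof -
  have b: "i \<le> k" "1 \<le> l" "l \<le> d + 1" "i' \<le> k" "1 \<le> l'" "l' \<le> d + 1"
    "ctr i' \<le> r + dn i' l'" "r \<le> ctr i + up i l"
    using assms by (auto simp: lab_def)
  have "i' = i + 1"
  proof (rule ccontr)
    assume "i' \<noteq> i + 1"
    then have "ctr (Suc i) + (d + 1) \<le> ctr i'" using assms(3) by (intro ctr_less) simp
    then show False using b up_le[of l i] dn_le[of l' i'] by (simp add: ctr_Suc)
  qed
  then show ?thesis using b by (simp add: \<Omega>\<^sub>2_def ctr_Suc up_def dn_def)
qed

text \<open>Offset 0 counts as a multiple of any \<open>m i\<close>, so two offsets of a row either
  belong to one orbit or come from paths of two orbits, where \<open>lab_pair\<close> applies. In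
  both cases their difference has a representative in \<open>\<Omega>\<close>.\<close>

lemma offs_pair:
  assumes "\<alpha> \<in> offs r" "\<beta> \<in> offs r"
  shows "(\<exists>i a b. i \<le> k \<and> a \<le> d + 1 \<and> b \<le> d + 1 \<and> \<alpha> = val (i, a) \<and> \<beta> = val (i, b) \<and>
            (a = 0 \<or> (i, a) \<in> lab r) \<and> (b = 0 \<or> (i, b) \<in> lab r)) \<or>
         (\<exists>x y. (x, y) \<in> \<Omega>\<^sub>2 \<union> prod.swap ` \<Omega>\<^sub>2 \<and> \<alpha> = val x \<and> \<beta> = val y)"
    (is "?same \<or> ?two")
proof -
  have same: ?same if "i \<le> k" "a \<le> d + 1" "b \<le> d + 1" "\<alpha> = val (i, a)" "\<beta> = val (i, b)"
      "a = 0 \<or> (i, a) \<in> lab r" "b = 0 \<or> (i, b) \<in> lab r" for i a b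
    using that by blast
  consider "\<alpha> = 0" "\<beta> = 0" | i l where "\<alpha> = 0" "\<beta> = val (i, l)" "(i, l) \<in> lab r"
    | i l where "\<beta> = 0" "\<alpha> = val (i, l)" "(i, l) \<in> lab r"
    | i l i' l' where "\<alpha> = val (i, l)" "(i, l) \<in> lab r" "\<beta> = val (i', l')" "(i', l') \<in> lab r"
    using assms unfolding offs_def by auto
  then show ?thesis
  proof cases
    case 1
    then show ?thesis using same[of 0 0 0] by simp
  next
    case 2
    then show ?thesis using same[of i 0 l] lab_bounds[of i l r] by simp
  next
    case 3
    then show ?thesis using same[of i l 0] lab_bounds[of i l r] by simp
  next
    case 4
    consider "i = i'" | "i < i'" | "i' < i" by linarith
    then show ?thesis
    proof cases
      case 1
      then show ?thesis using same[of i l l'] 4 lab_bounds[of i l r] lab_bounds[of i' l' r] by simp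
    next
      case 2
      then show ?thesis using lab_pair[OF 4(2,4)] 4 by blast
    next
      case 3
      then have "((i, l), (i', l')) \<in> prod.swap ` \<Omega>\<^sub>2" using lab_pair[OF 4(4,2)] by force
      then show ?thesis using 4 by blast
    qed
  qed
qed


section \<open>Rows and hats\<close>

lemma lab_ctr:
  assumes "i \<le> k"
  shows "lab (ctr i) = {i} \<times> {1..d+1}"
proof -
  have "j = i" if "(j, l) \<in> lab (ctr i)" for j l
  proof (rule ccontr)
    assume "j \<noteq> i"
    have b: "j \<le> k" "1 \<le> l" "l \<le> d + 1" "ctr j \<le> ctr i + dn j l" "ctr i \<le> ctr j + up j l"
      using that by (auto simp: lab_def)
    then show False
      using \<open>j \<noteq> i\<close> ctr_less[of j i] ctr_less[of i j] up_le[of l j] dn_le[of l j] by linarith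
  qed
  moreover have "(i, l) \<in> lab (ctr i)" if "1 \<le> l" "l \<le> d + 1" for l
    using that assms by (simp add: lab_def)
  ultimately show ?thesis using lab_bounds by fastforce
qed

lemma lab_between:
  assumes "i < k" "1 \<le> s" "s \<le> d"
  shows "lab (ctr i + s) = {i} \<times> {l \<in> {1..d+1}. s \<le> \<tau> (i + 1) (l - 1)} \<union>
    {i + 1} \<times> {l \<in> {1..d+1}. d + 1 - s \<le> \<sigma> (i + 1) (l - 1)}" (is "_ = ?R")
proof -
  have *: "(j, l) \<in> lab (ctr i + s) \<longleftrightarrow> (j, l) \<in> ?R" for j l
  proof -
    consider "j = i" | "j = i + 1" | "j < i" | "i + 1 < j" by linarith
    then show ?thesis
    proof cases
      case 1
      then show ?thesis using assms by (auto simp: lab_def up_def)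
    next
      case 2
      have "ctr (i + 1) = ctr i + (d + 1)" using ctr_Suc[of i] by simp
      then show ?thesis using assms 2 by (auto simp: lab_def dn_def)
    next
      case 3
      then show ?thesis using assms ctr_less[of j i] up_le[of l j] by (auto simp: lab_def)
    next
      case 4
      then show ?thesis using assms ctr_less[of "i + 1" j] ctr_Suc[of i] dn_le[of l j] by (auto simp: lab_def)
    qed
  qed
  show ?thesis
  proof (rule Set.set_eqI)
    show "x \<in> lab (ctr i + s) \<longleftrightarrow> x \<in> ?R" for x
      using * by (cases x) (simp only:)
  qed
qed

text \<open>At height \<open>s\<close> between two orbit rows, d + 1 - s outward paths are left and
  \<open>s\<close> inward paths have arrived.\<close>

lemma card_lab:
  assumes "r \<le> ctr k"
  shows "card (lab r) = d + 1"
proof -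
  obtain i s where r: "r = ctr i + s" "s \<le> d" "i < k \<or> i = k \<and> s = 0"
    using row_cases[OF assms] .
  show ?thesis
  proof (cases "s = 0")
    case True
    then show ?thesis using r lab_ctr[of i] by auto
  next
    case False
    then have ii: "i < k" "1 \<le> s" using r by auto
    define L L' where "L = {l \<in> {1..d+1}. s \<le> \<tau> (i + 1) (l - 1)}"
      and "L' = {l \<in> {1..d+1}. d + 1 - s \<le> \<sigma> (i + 1) (l - 1)}"
    have "card (lab r) = card ({i} \<times> L \<union> {i + 1} \<times> L')"
      unfolding r(1) lab_between[OF ii r(2)] L_def L'_def ..
    also have "\<dots> = card ({i} \<times> L) + card ({i + 1} \<times> L')"
      by (rule card_Un_disjoint) (auto simp: L_def L'_def)
    also have "\<dots> = card L + card L'" by (simp add: card_cartesian_product)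
    also have "card L = d + 1 - s"
      unfolding L_def by (rule card_permutes_ge) (use \<tau>_permutes[of "i+1"] ii in simp)
    also have "card L' = d + 1 - (d + 1 - s)"
      unfolding L'_def by (rule card_permutes_ge) (use \<sigma>_permutes[of "i+1"] ii in simp)
    finally show ?thesis using r(2) by simp
  qed
qed

lemma finite_lab: "r \<le> ctr k \<Longrightarrow> finite (lab r)"
  using card_lab[of r] card.infinite by fastforce

text \<open>The lengths of the outward paths of one orbit are distinct, and those of different
  orbits end in disjoint ranges of rows. So a step to the next row loses at most one label. In the
  last row all labels of orbit \<open>k\<close> end together, hence
  \<open>r < ctr k\<close>.\<close>

lemma lab_leave:
  assumes "(i, l) \<in> lab r" "(i', l') \<in> lab r" "r = ctr i + up i l" "r = ctr i' + up i' l'" "r < ctr k"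
  shows "i = i' \<and> l = l'"
proof -
  have b: "1 \<le> l" "l \<le> d + 1" "1 \<le> l'" "l' \<le> d + 1" "i \<le> k" "i' \<le> k"
    using assms lab_bounds by auto
  have ii: "i = i'"
    using assms(3,4) b up_le[of l i] up_le[of l' i'] ctr_less[of i i'] ctr_less[of i' i]
    by (cases i i' rule: linorder_cases) auto
  have "i \<noteq> k" using assms(3,5) by auto
  then have "i < k" using b by simp
  then have "\<tau> (i + 1) (l - 1) = \<tau> (i + 1) (l' - 1)" using assms(3,4) ii by (simp add: up_def)
  then have "l - 1 = l' - 1"
    using permutes_inj[OF \<tau>_permutes[of "i + 1"]] \<open>i < k\<close> by (auto dest: injD)
  then show ?thesis using ii b by simp
qed

lemma card_lab_Suc:
  assumes "r < ctr k"
  shows "d \<le> card (lab r \<inter> lab (Suc r))"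
proof -
  have leave: "r = ctr i + up i l" if "(i, l) \<in> lab r" "(i, l) \<notin> lab (Suc r)" for i l
    using that by (auto simp: lab_def)
  have "p = q" if "p \<in> lab r - lab (Suc r)" "q \<in> lab r - lab (Suc r)" for p q
  proof -
    obtain i l i' l' where pq: "p = (i, l)" "q = (i', l')" by (meson surj_pair)
    have in_lab: "(i, l) \<in> lab r" "(i, l) \<notin> lab (Suc r)" "(i', l') \<in> lab r" "(i', l') \<notin> lab (Suc r)"
      using that unfolding pq by blast+
    from lab_leave[OF in_lab(1,3) leave[OF in_lab(1,2)] leave[OF in_lab(3,4)] assms]
    show ?thesis unfolding pq by simp
  qed
  moreover have "finite (lab r - lab (Suc r))" using finite_lab[of r] assms by simp
  ultimately have "card (lab r - lab (Suc r)) \<le> 1"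
    unfolding One_nat_def by (subst card_le_Suc0_iff_eq) blast+
  moreover have "card (lab r - lab (Suc r)) = card (lab r) - card (lab r \<inter> lab (Suc r))"
    by (rule card_Diff_subset_Int) (use finite_lab[of r] assms in auto)
  ultimately show ?thesis using card_lab[of r] assms by simp
qed

text \<open>A label confined to its orbit row is excluded by condition (ii) for
  \<open>l \<le> d\<close> and by condition (iii) for \<open>l = d + 1\<close>.\<close>

lemma zero_up_unique_zero_dn:
  assumes "1 \<le> i" "i < k" "1 \<le> l" "l \<le> d + 1" "up i l = 0"
  shows "dn i l \<noteq> 0"
proof
  assume "dn i l = 0"
  then have 0: "\<tau> (i + 1) (l - 1) = 0" "\<sigma> i (l - 1) = 0" using assms by (auto simp: up_def dn_def)
  have "l - 1 \<noteq> d" using last[of "i + 1"] assms 0 by auto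
  then have "l - 1 \<le> d - 1" using assms(4) by linarith
  then show False using cross[of "i + 1" "l - 1"] assms(1,2) 0 by simp
qed

lemma ex_up:
  assumes "i < k" "s \<le> d"
  obtains l where "1 \<le> l" "l \<le> d + 1" "up i l = s"
proof -
  have "s \<in> \<tau> (i + 1) ` {0..d}"
    using permutes_image[OF \<tau>_permutes[of "i + 1"]] assms by auto
  then obtain t where "t \<le> d" "s = \<tau> (i + 1) t" by auto
  then show ?thesis using that[of "t + 1"] assms by (simp add: up_def)
qed

lemma ex_dn:
  assumes "1 \<le> i" "i \<le> k" "s \<le> d"
  obtains l where "1 \<le> l" "l \<le> d + 1" "dn i l = s"
proof -
  have "s \<in> \<sigma> i ` {0..d}"
    using permutes_image[OF \<sigma>_permutes[of i]] assms by auto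
  then obtain t where "t \<le> d" "s = \<sigma> i t" by auto
  then show ?thesis using that[of "t + 1"] assms by (simp add: dn_def)
qed

text \<open>Two of the d + 1 labels of row \<open>r\<close> or \<open>r'\<close> are lost. If no
  orbit row lies strictly between, the outward paths of lengths \<open>s\<close> and
  \<open>s + 1\<close> end before \<open>r'\<close>. Otherwise a common label must cross the orbit
  row of \<open>j\<close> on both sides, which excludes the labels with \<open>up j l = 0\<close>
  and with \<open>dn j l' = 0\<close>; these differ by the preceding confinement argument.\<close>

lemma card_lab_far:
  assumes "r + 2 \<le> r'" "r' \<le> ctr k"
  shows "card (lab r \<inter> lab r') < d"
proof -
  have rk: "r \<le> ctr k" using assms by simp
  obtain i s where r: "r = ctr i + s" "s \<le> d" "i < k \<or> i = k \<and> s = 0"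
    using row_cases[OF rk] .
  have i: "i < k" using r assms by auto
  show ?thesis
  proof (cases "r' \<le> ctr (Suc i)")
    case True
    then have s: "s + 1 \<le> d" using assms(1) r(1) by (simp add: ctr_Suc)
    obtain l where l: "1 \<le> l" "l \<le> d + 1" "up i l = s" using ex_up[OF i r(2)] .
    obtain l' where l': "1 \<le> l'" "l' \<le> d + 1" "up i l' = s + 1" using ex_up[OF i s] .
    have in1: "(i, l) \<in> lab r" "(i, l') \<in> lab r" "(i, l) \<noteq> (i, l')"
      using i l l' r(1) by (auto simp: lab_def)
    have "(i, l) \<notin> lab r'" "(i, l') \<notin> lab r'" using assms(1) l l' r(1) by (auto simp: lab_def)
    then have "card (lab r \<inter> lab r') \<le> card (lab r - {(i, l), (i, l')})"
      using finite_lab[OF rk] by (intro card_mono) auto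
    also have "\<dots> = d - 1"
      using card_lab[OF rk] in1 finite_lab[OF rk] by (subst card_Diff_subset) auto
    finally show ?thesis using d by simp
  next
    case False
    define j where "j = Suc i"
    have j: "1 \<le> j" "j < k"
      using False assms(2) i ctr_mono[of k j] by (auto simp: j_def not_less_eq_eq intro: ccontr)
    have r_lt: "r < ctr j" "ctr j < r'" using False r by (auto simp: j_def ctr_Suc)
    obtain l where l: "1 \<le> l" "l \<le> d + 1" "up j l = 0" using ex_up[OF j(2), of 0] by auto
    obtain l' where l': "1 \<le> l'" "l' \<le> d + 1" "dn j l' = 0" using ex_dn[of j 0] j by auto
    have "l \<noteq> l'" using zero_up_unique_zero_dn[OF j l] l' by auto
    have "lab r \<inter> lab r' \<subseteq> {j} \<times> ({1..d+1} - {l, l'})"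
    proof clarify
      fix a b assume ab: "(a, b) \<in> lab r" "(a, b) \<in> lab r'"
      then have b: "a \<le> k" "1 \<le> b" "b \<le> d + 1" "ctr a \<le> r + dn a b" "r' \<le> ctr a + up a b"
        by (auto simp: lab_def)
      have "a = j"
        using b r_lt r up_le[of b a] dn_le[of b a] ctr_less[of a j] ctr_less[of j a]
        by (cases a j rule: linorder_cases) auto
      then show "a \<in> {j} \<and> b \<in> {1..d+1} - {l, l'}"
        using b r_lt l l' by auto
    qed
    then have "card (lab r \<inter> lab r') \<le> card ({j} \<times> ({1..d+1} - {l, l'}))"
      by (intro card_mono) auto
    also have "\<dots> = card ({1..d+1} - {l, l'})" by (simp only: card_cartesian_product) simp
    also have "\<dots> = d - 1"
      using l l' \<open>l \<noteq> l'\<close> by (subst card_Diff_subset) auto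
    finally show ?thesis using d by simp
  qed
qed

text \<open>Off the orbit row, one label of orbit \<open>i\<close> is missing on either side: the
  one whose path in that direction has length 0. Condition (iii) says that this is not label
  \<open>d + 1\<close>, so labels up to \<open>d\<close> already detect it.\<close>

lemma row_eq_ctr:
  assumes "i \<le> k" "\<And>l. 1 \<le> l \<Longrightarrow> l \<le> d \<Longrightarrow> (i, l) \<in> lab r"
  shows "r = ctr i"
proof (rule ccontr)
  assume "r \<noteq> ctr i"
  have l1: "(i, 1) \<in> lab r" using assms(2)[of 1] d by simp
  consider "r < ctr i" | "ctr i < r" using \<open>r \<noteq> ctr i\<close> by linarith
  then show False
  proof cases
    case 1
    then have i: "1 \<le> i" by (cases i) auto
    obtain l where l: "1 \<le> l" "l \<le> d + 1" "dn i l = 0" using ex_dn[of i 0] i assms(1) by auto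
    then have "l \<noteq> d + 1" using last[of i] i assms(1) by (auto simp: dn_def)
    then show False using assms(2)[of l] l 1 by (auto simp: lab_def)
  next
    case 2
    show False
    proof (cases "i < k")
      case True
      obtain l where l: "1 \<le> l" "l \<le> d + 1" "up i l = 0" using ex_up[of i 0] True by auto
      then have "l \<noteq> d + 1" using last[of "i + 1"] True by (auto simp: up_def)
      then show False using assms(2)[of l] l 2 by (auto simp: lab_def)
    next
      case False
      then show False using l1 2 by (auto simp: lab_def up_def)
    qed
  qed
qed

lemma offs_Int: "offs r \<inter> offs r' = insert 0 (val ` (lab r \<inter> lab r'))"
proof -
  have "val ` lab r \<inter> val ` lab r' = val ` (lab r \<inter> lab r')"
    by (rule inj_on_image_Int[symmetric, OF inj_on_val_lab]) auto
  then show ?thesis by (auto simp: offs_def)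
qed

lemma card_offs_Int: "r \<le> ctr k \<Longrightarrow> card (offs r \<inter> offs r') = Suc (card (lab r \<inter> lab r'))"
proof -
  assume "r \<le> ctr k"
  have "0 \<notin> val ` (lab r \<inter> lab r')" using zero_notin_val_lab[of r] by blast
  moreover have "card (val ` (lab r \<inter> lab r')) = card (lab r \<inter> lab r')"
    by (rule card_image, rule inj_on_subset[OF inj_on_val_lab]) auto
  ultimately show ?thesis using finite_lab[OF \<open>r \<le> ctr k\<close>] by (simp add: offs_Int)
qed

lemma card_offs: "r \<le> ctr k \<Longrightarrow> card (offs r) = d + 2"
  using card_offs_Int[of r r] card_lab[of r] by simp

section \<open>Hats as reflected sets of offsets\<close>

definition Hat :: "nat \<times> int \<Rightarrow> int set" where
  "Hat u = {j \<in> Zmod n. (snd u - j) mod N \<in> offs (fst u)}"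

lemma bij_betw_reflect:
  assumes "B \<subseteq> Zmod n"
  shows "bij_betw (\<lambda>j. (x - j) mod N) {j \<in> Zmod n. (x - j) mod N \<in> B} B"
proof (rule bij_betw_byWitness[where f' = "\<lambda>j. (x - j) mod N"])
  have inv: "(x - (x - j) mod N) mod N = j" if "j \<in> Zmod n" for j
    using Zmod_mod[OF that] by (simp add: mod_diff_right_eq)
  then show "\<forall>a\<in>{j \<in> Zmod n. (x - j) mod N \<in> B}. (x - (x - a) mod N) mod N = a" by blast
  show "\<forall>a'\<in>B. (x - (x - a') mod N) mod N = a'" using inv assms by blast
  show "(\<lambda>j. (x - j) mod N) ` {j \<in> Zmod n. (x - j) mod N \<in> B} \<subseteq> B" by blast
  show "(\<lambda>j. (x - j) mod N) ` B \<subseteq> {j \<in> Zmod n. (x - j) mod N \<in> B}"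
    using inv assms by (auto simp del: partial_object.simps)
qed

lemma card_reflect: "B \<subseteq> Zmod n \<Longrightarrow> card {j \<in> Zmod n. (x - j) mod N \<in> B} = card B"
  using bij_betw_same_card[OF bij_betw_reflect] .

lemma card_translate:
  assumes "B \<subseteq> Zmod n"
  shows "card {x \<in> Zmod n. (x - j) mod N \<in> B} = card B"
proof -
  have "bij_betw (\<lambda>x. (x - j) mod N) {x \<in> Zmod n. (x - j) mod N \<in> B} B"
  proof (rule bij_betw_byWitness[where f' = "\<lambda>y. (y + j) mod N"])
    have inv: "((x - j) mod N + j) mod N = x" "((x + j) mod N - j) mod N = x" if "x \<in> Zmod n" for x
      using Zmod_mod[OF that] by (simp_all add: mod_diff_left_eq mod_add_left_eq)
    then show "\<forall>a\<in>{x \<in> Zmod n. (x - j) mod N \<in> B}. ((a - j) mod N + j) mod N = a" by blast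
    show "\<forall>a'\<in>B. ((a' + j) mod N - j) mod N = a'" using inv assms by blast
    show "(\<lambda>x. (x - j) mod N) ` {x \<in> Zmod n. (x - j) mod N \<in> B} \<subseteq> B" by blast
    show "(\<lambda>y. (y + j) mod N) ` B \<subseteq> {x \<in> Zmod n. (x - j) mod N \<in> B}"
      using inv assms by (auto simp del: partial_object.simps)
  qed
  then show ?thesis by (rule bij_betw_same_card)
qed

lemma finite_Zmod: "finite (Zmod n)" unfolding Zmod_eq by simp

lemma finite_Hat: "finite (Hat u)"
  unfolding Hat_def using finite_Zmod by (rule rev_finite_subset) blast

lemma card_Hat: "r \<le> ctr k \<Longrightarrow> card (Hat (r, x)) = d + 2"
  using card_reflect[OF offs_subset, of x r] card_offs[of r] by (simp add: Hat_def)

lemma card_Hat_Int_same: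
  "r \<le> ctr k \<Longrightarrow> card (Hat (r, x) \<inter> Hat (r', x)) = Suc (card (lab r \<inter> lab r'))"
proof -
  assume r: "r \<le> ctr k"
  have "Hat (r, x) \<inter> Hat (r', x) = {j \<in> Zmod n. (x - j) mod N \<in> offs r \<inter> offs r'}"
    unfolding Hat_def by auto
  moreover have "offs r \<inter> offs r' \<subseteq> Zmod n" using offs_subset by blast
  ultimately show ?thesis using card_reflect[of "offs r \<inter> offs r'" x] card_offs_Int[OF r] by metis
qed

text \<open>The elements of \<open>C\<close> are common to two hats, and \<open>f\<close>,
  \<open>g\<close> give their multiples of \<open>m i\<close> in each. The d + 1 values of
  \<open>f\<close> have to fit into \<open>{b..d+1}\<close>, so \<open>b = 1\<close>,
  \<open>f\<close> takes all values from 1 to d + 1, and \<open>g\<close> takes those from 0 to d.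
  Hence both rows contain the labels 1 to d of orbit \<open>i\<close>.\<close>

lemma orbit_shift:
  fixes f g :: "int \<Rightarrow> nat"
  assumes C: "finite C" "d + 1 \<le> card C" "inj_on f C" and i: "i \<le> k"
    and fg: "\<And>j. j \<in> C \<Longrightarrow> f j = g j + b" "0 < b" and f: "\<And>j. j \<in> C \<Longrightarrow> f j \<le> d + 1"
    and labf: "\<And>j. j \<in> C \<Longrightarrow> f j = 0 \<or> (i, f j) \<in> lab r"
    and labg: "\<And>j. j \<in> C \<Longrightarrow> g j = 0 \<or> (i, g j) \<in> lab r'"
  shows "b = 1" "r = ctr i" "r' = ctr i"
proof -
  have sub: "f ` C \<subseteq> {b..d+1}" using fg f by auto
  have "card (f ` C) = card C" by (rule card_image) fact
  moreover have "card (f ` C) \<le> card {b..d+1}" by (rule card_mono) (use sub in auto)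
  ultimately show b: "b = 1" using C(2) fg(2) by simp
  have img: "f ` C = {1..d+1}"
    by (rule card_subset_eq) (use sub b C \<open>card (f ` C) = card C\<close> card_mono[OF _ sub] in auto)
  show "r = ctr i"
  proof (rule row_eq_ctr[OF i])
    fix l assume "1 \<le> l" "l \<le> d"
    then have "l \<in> f ` C" using img by simp
    then show "(i, l) \<in> lab r" using labf \<open>1 \<le> l\<close> by force
  qed
  show "r' = ctr i"
  proof (rule row_eq_ctr[OF i])
    fix l assume "1 \<le> l" "l \<le> d"
    then have "l + 1 \<in> f ` C" using img by simp
    then obtain j where "j \<in> C" "g j = l" using fg(1) b by force
    then show "(i, l) \<in> lab r'" using labg[of j] \<open>1 \<le> l\<close> by auto
  qed
qed

text \<open>On vertices of the graph this is its edge relation, put in terms of column differences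
  so that it can be read off from offsets.\<close>

definition adj :: "nat \<times> int \<Rightarrow> nat \<times> int \<Rightarrow> bool" where
  "adj u v \<longleftrightarrow> snd u = snd v \<and> (fst u = Suc (fst v) \<or> fst v = Suc (fst u)) \<or>
     fst u = fst v \<and> (\<exists>i\<le>k. fst u = ctr i \<and>
       ((snd u - snd v) mod N = val (i, 1) \<or> (snd v - snd u) mod N = val (i, 1)))"


section \<open>Ridges\<close>

lemma translate_inj: "x \<in> Zmod n \<Longrightarrow> y \<in> Zmod n \<Longrightarrow> (x - j) mod N = (y - j) mod N \<Longrightarrow> x = y"
  by (metis Zmod_mod diff_add_cancel mod_add_left_eq)

lemma reflect_inj: "j \<in> Zmod n \<Longrightarrow> j' \<in> Zmod n \<Longrightarrow> (x - j) mod N = (x - j') mod N \<Longrightarrow> j = j'"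
  by (metis Zmod_mod diff_diff_eq2 add_diff_cancel_left' mod_diff_right_eq)

lemma \<Omega>\<^sub>2_symD:
  "p \<in> \<Omega>\<^sub>2 \<union> prod.swap ` \<Omega>\<^sub>2 \<Longrightarrow> p \<in> \<Omega> \<and> fst (fst p) \<noteq> fst (snd p)"
proof -
  assume "p \<in> \<Omega>\<^sub>2 \<union> prod.swap ` \<Omega>\<^sub>2"
  then have p: "p \<in> \<Omega>\<^sub>2 \<or> prod.swap p \<in> \<Omega>\<^sub>2" by auto
  then have "fst (fst p) \<noteq> fst (snd p)" by (cases p) (auto simp: \<Omega>\<^sub>2_def)
  then show ?thesis using p \<Omega>I by blast
qed

lemma diff_Pair: "diff (u, v) = (val u - val v) mod N"
  by (simp add: diff_def)

lemma fst_step: "fst (fst (step i a b)) = fst (snd (step i a b))"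
  by (simp add: step_def)

text \<open>Two columns \<open>x \<noteq> y\<close> share two elements only if all four offsets are multiples of one
  common \<open>m i\<close>: a difference of multiples of two different \<open>m i\<close>'s determines its two terms.\<close>

lemma two_common_elements:
  assumes j: "j \<in> Hat (r, x) \<inter> Hat (r', y)" "j' \<in> Hat (r, x) \<inter> Hat (r', y)" "j \<noteq> j'"
    and xy: "x \<in> Zmod n" "y \<in> Zmod n" "x \<noteq> y"
  obtains i a b a' b' where "i \<le> k" "a \<le> d + 1" "b \<le> d + 1" "a' \<le> d + 1" "b' \<le> d + 1"
    "(x - j) mod N = val (i, a)" "(x - j') mod N = val (i, b)"
    "(y - j) mod N = val (i, a')" "(y - j') mod N = val (i, b')" "a + b' = a' + b"
    "b = 0 \<or> (i, b) \<in> lab r" "b' = 0 \<or> (i, b') \<in> lab r'"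
    "a = 0 \<or> (i, a) \<in> lab r" "a' = 0 \<or> (i, a') \<in> lab r'"
proof -
  define \<alpha> \<beta> \<alpha>' \<beta>' where "\<alpha> = (x - j) mod N" and "\<beta> = (x - j') mod N"
    and "\<alpha>' = (y - j) mod N" and "\<beta>' = (y - j') mod N"
  note defs = \<alpha>_def \<beta>_def \<alpha>'_def \<beta>'_def
  have jZ: "j \<in> Zmod n" "j' \<in> Zmod n" using j unfolding Hat_def by blast+
  have offs: "\<alpha> \<in> offs r" "\<beta> \<in> offs r" "\<alpha>' \<in> offs r'" "\<beta>' \<in> offs r'"
    using j by (auto simp: Hat_def defs)
  have "(\<alpha> - \<beta>) mod N = (j' - j) mod N" "(\<alpha>' - \<beta>') mod N = (j' - j) mod N"
    by (simp_all add: defs mod_diff_eq)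
  then have eq: "(\<alpha> - \<beta>) mod N = (\<alpha>' - \<beta>') mod N" by simp
  have ne: "\<alpha> \<noteq> \<beta>" using reflect_inj[OF jZ, of x] j(3) by (auto simp: defs)
  have ne': "\<alpha> \<noteq> \<alpha>'" using translate_inj[OF xy(1,2), of j] xy(3) by (auto simp: defs)
  have uniq: "p = q" if "p \<in> \<Omega>" "q \<in> \<Omega>" "diff p = (\<alpha> - \<beta>) mod N" "diff q = (\<alpha>' - \<beta>') mod N" for p q
    using inj_onD[OF inj_diff] that eq by metis
  consider (s) i a b where "i \<le> k" "a \<le> d + 1" "b \<le> d + 1" "\<alpha> = val (i, a)" "\<beta> = val (i, b)"
      "a = 0 \<or> (i, a) \<in> lab r" "b = 0 \<or> (i, b) \<in> lab r"
    | (t) u v where "(u, v) \<in> \<Omega>\<^sub>2 \<union> prod.swap ` \<Omega>\<^sub>2" "\<alpha> = val u" "\<beta> = val v"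
    using offs_pair[OF offs(1,2)] by metis
  note c1 = this
  consider (s) i a b where "i \<le> k" "a \<le> d + 1" "b \<le> d + 1" "\<alpha>' = val (i, a)" "\<beta>' = val (i, b)"
      "a = 0 \<or> (i, a) \<in> lab r'" "b = 0 \<or> (i, b) \<in> lab r'"
    | (t) u v where "(u, v) \<in> \<Omega>\<^sub>2 \<union> prod.swap ` \<Omega>\<^sub>2" "\<alpha>' = val u" "\<beta>' = val v"
    using offs_pair[OF offs(3,4)] by metis
  note c2 = this
  \<comment> \<open>Only the case of multiples of one \<open>m i\<close> on both sides survives. A
    \<open>step\<close> stays in one orbit and a pair of \<open>\<Omega>\<^sub>2\<close> does not,
    which excludes the mixed cases; two pairs of different orbits would coincide and give
    \<open>\<alpha> = \<alpha>'\<close>, that is \<open>x = y\<close>.\<close>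
  show ?thesis
  proof (cases rule: c1)
    case c1: (s i a b)
    show ?thesis
    proof (cases rule: c2)
      case c2: (s i' a' b')
      have ab: "a \<noteq> b" using ne c1(4,5) by auto
      note u = val_diff_unique[OF c1(1) c2(1) c1(2,3) c2(2,3) eq[unfolded c1(4,5) c2(4,5)]]
      have "i' = i" using u(1)[OF ab] by simp
      show ?thesis
        by (rule that[of i a b a' b']) (use c1 c2 u(2) \<open>i' = i\<close> in \<open>simp_all add: defs\<close>)
    next
      case c2: (t u v)
      have "step i a b = (u, v)"
        by (rule uniq) (use \<Omega>\<^sub>2_symD[OF c2(1)] step_in_\<Omega>[OF c1(1-3)] c1 c2 in \<open>simp_all add: diff_step diff_Pair\<close>)
      then show ?thesis using \<Omega>\<^sub>2_symD[OF c2(1)] fst_step[of i a b] by simp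
    qed
  next
    case c1: (t u v)
    show ?thesis
    proof (cases rule: c2)
      case c2: (s i' a' b')
      have "(u, v) = step i' a' b'"
        by (rule uniq) (use \<Omega>\<^sub>2_symD[OF c1(1)] step_in_\<Omega>[OF c2(1-3)] c1 c2 in \<open>simp_all add: diff_step diff_Pair\<close>)
      then show ?thesis using \<Omega>\<^sub>2_symD[OF c1(1)] fst_step[of i' a' b'] by simp
    next
      case c2: (t u' v')
      have "(u, v) = (u', v')"
        by (rule uniq) (use \<Omega>\<^sub>2_symD[OF c1(1)] \<Omega>\<^sub>2_symD[OF c2(1)] c1 c2 in \<open>simp_all add: diff_Pair\<close>)
      then show ?thesis using ne' c1 c2 by simp
    qed
  qed
qed

text \<open>In one column, \<open>card_lab_far\<close> leaves only neighbouring rows. In different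
  columns, every common element is compared with a fixed one \<open>c\<close>; all offsets become
  multiples of the same \<open>m i\<close>, with a constant shift between the two hats, and
  \<open>orbit_shift\<close> applies.\<close>

lemma Hat_adj:
  assumes rk: "r \<le> ctr k" "r' \<le> ctr k" and xy: "x \<in> Zmod n" "y \<in> Zmod n"
    and ne: "(r, x) \<noteq> (r', y)" and big: "d + 1 \<le> card (Hat (r, x) \<inter> Hat (r', y))"
  shows "adj (r, x) (r', y)"
proof (cases "x = y")
  case True
  have "\<not> r + 2 \<le> r'"
    using card_lab_far[of r r'] card_Hat_Int_same[OF rk(1), of x r'] big rk True by auto
  moreover have "\<not> r' + 2 \<le> r"
    using card_lab_far[of r' r] card_Hat_Int_same[OF rk(2), of x r] big rk True
    by (auto simp: Int_commute)
  ultimately show ?thesis using ne True by (auto simp: adj_def)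
next
  case False
  define C where "C = Hat (r, x) \<inter> Hat (r', y)"
  have finC: "finite C" using finite_Hat by (simp add: C_def)
  have CZ: "C \<subseteq> Zmod n" unfolding C_def Hat_def by blast
  have big: "d + 1 \<le> card C" using big by (simp add: C_def)
  have "\<not> card C \<le> Suc 0" using big d by simp
  then obtain p q where pq: "p \<in> C" "q \<in> C" "p \<noteq> q" using card_le_Suc0_iff_eq[OF finC] by blast
  \<comment> \<open>Offset 0 is a multiple of every \<open>m i\<close> and would not determine
    \<open>i\<close>. At most one common element has it, so \<open>c\<close> can be chosen with a
    nonzero offset.\<close>
  have "(x - p) mod N \<noteq> 0 \<or> (x - q) mod N \<noteq> 0"
    using reflect_inj[of p q x] pq CZ by (metis subsetD)
  then obtain c e where ce: "c \<in> C" "e \<in> C" "c \<noteq> e" "(x - c) mod N \<noteq> 0" using pq by metis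
  from two_common_elements[OF ce(1,2)[unfolded C_def] ce(3) xy False]
  obtain i a a' where i: "i \<le> k" and a: "a \<le> d + 1" "a' \<le> d + 1" "(x - c) mod N = val (i, a)"
    "(y - c) mod N = val (i, a')" "a = 0 \<or> (i, a) \<in> lab r" "a' = 0 \<or> (i, a') \<in> lab r'" by metis
  have a0: "a \<noteq> 0" using ce(4) a(3) by (metis val_0)
  define P where "P j b b' \<longleftrightarrow> b \<le> d + 1 \<and> b' \<le> d + 1 \<and> (x - j) mod N = val (i, b) \<and>
     (y - j) mod N = val (i, b') \<and> a + b' = a' + b \<and> (b = 0 \<or> (i, b) \<in> lab r) \<and>
     (b' = 0 \<or> (i, b') \<in> lab r')" for j b b'
  have "\<exists>b b'. P j b b'" if j: "j \<in> C" for j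
  proof (cases "j = c")
    case True
    then show ?thesis using a by (intro exI[of _ a] exI[of _ a']) (simp add: P_def)
  next
    case jc: False
    obtain i1 a1 b a1' b' where *: "i1 \<le> k" "a1 \<le> d + 1" "b \<le> d + 1" "a1' \<le> d + 1" "b' \<le> d + 1"
      "(x - c) mod N = val (i1, a1)" "(x - j) mod N = val (i1, b)"
      "(y - c) mod N = val (i1, a1')" "(y - j) mod N = val (i1, b')" "a1 + b' = a1' + b"
      "b = 0 \<or> (i1, b) \<in> lab r" "b' = 0 \<or> (i1, b') \<in> lab r'"
      "a1 = 0 \<or> (i1, a1) \<in> lab r" "a1' = 0 \<or> (i1, a1') \<in> lab r'"
      by (rule two_common_elements[OF ce(1)[unfolded C_def] j[unfolded C_def] jc[symmetric] xy False])
    have "i = i1 \<and> a = a1" by (rule val_inj) (use i * a a0 in auto)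
    moreover from this have "a' = a1'" by (intro val_same_inj[OF i]) (use * a in auto)
    ultimately show ?thesis using * by (intro exI[of _ b] exI[of _ b']) (simp add: P_def)
  qed
  then have "\<forall>j\<in>C. \<exists>b b'. P j b b'" by blast
  from bchoice[OF this] obtain f where "\<forall>j\<in>C. \<exists>b'. P j (f j) b'" by blast
  from bchoice[OF this] obtain g where "\<forall>j\<in>C. P j (f j) (g j)" by blast
  then have fg: "\<And>j. j \<in> C \<Longrightarrow> f j \<le> d + 1" "\<And>j. j \<in> C \<Longrightarrow> g j \<le> d + 1"
    "\<And>j. j \<in> C \<Longrightarrow> (x - j) mod N = val (i, f j)" "\<And>j. j \<in> C \<Longrightarrow> (y - j) mod N = val (i, g j)"
    "\<And>j. j \<in> C \<Longrightarrow> a + g j = a' + f j" "\<And>j. j \<in> C \<Longrightarrow> f j = 0 \<or> (i, f j) \<in> lab r"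
    "\<And>j. j \<in> C \<Longrightarrow> g j = 0 \<or> (i, g j) \<in> lab r'"
    by (simp_all add: P_def)
  have inj: "inj_on f C" "inj_on g C"
    using fg(3,4) reflect_inj CZ by (metis inj_onI subsetD)+
  have sub: "(x - y) mod N = (val (i, a) - val (i, a')) mod N"
    unfolding a(3,4)[symmetric] by (simp add: mod_diff_eq)
  consider "a = a'" | "a' < a" | "a < a'" by linarith
  then show ?thesis
  proof cases
    case 1
    then have "x = y" using a(3,4) xy by (intro translate_inj[of x y c]) auto
    then show ?thesis using False by simp
  next
    case 2
    have *: "f j = g j + (a - a')" if "j \<in> C" for j using fg(5)[OF that] 2 by linarith
    have pos: "0 < a - a'" using 2 by simp
    note s = orbit_shift[OF finC big inj(1) i * pos fg(1) fg(6) fg(7)]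
    have "a = a' + 1" using s(1) 2 by simp
    then have "(x - y) mod N = val (i, 1)"
      unfolding sub by (simp add: val_def mod_diff_eq algebra_simps)
    then show ?thesis using s(2,3) i unfolding adj_def by auto
  next
    case 3
    have *: "g j = f j + (a' - a)" if "j \<in> C" for j using fg(5)[OF that] 3 by linarith
    have pos: "0 < a' - a" using 3 by simp
    note s = orbit_shift[OF finC big inj(2) i * pos fg(2) fg(7) fg(6)]
    have "a' = a + 1" using s(1) 3 by simp
    have "(y - x) mod N = (val (i, a') - val (i, a)) mod N"
      unfolding a(3,4)[symmetric] by (simp add: mod_diff_eq)
    then have "(y - x) mod N = val (i, 1)"
      using \<open>a' = a + 1\<close> by (simp add: val_def mod_diff_eq algebra_simps)
    then show ?thesis using s(2,3) i unfolding adj_def by auto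
  qed
qed

text \<open>The signs of the three steps give an odd combination \<open>s + t - w\<close>, so
  \<open>N\<close> would divide \<open>m i\<close> or \<open>3 * m i\<close> up to sign. Both are
  nonzero residues, since \<open>d \<ge> 2\<close> gives 3 at most d + 1.\<close>

lemma no_orbit_triangle:
  assumes i: "i \<le> k"
    and "(x - y) mod N = val (i, 1) \<or> (y - x) mod N = val (i, 1)"
    and "(y - z) mod N = val (i, 1) \<or> (z - y) mod N = val (i, 1)"
    and "(x - z) mod N = val (i, 1) \<or> (z - x) mod N = val (i, 1)"
  shows False
proof -
  have pm: "\<exists>s\<in>{1, -1}. N dvd (u - v) - s * m i"
    if "(u - v) mod N = val (i, 1) \<or> (v - u) mod N = val (i, 1)" for u v
  proof -
    have "N dvd (u - v) - m i \<or> N dvd (v - u) - m i"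
      using that by (simp add: val_def mod_eq_dvd_iff)
    moreover have "(v - u) - m i = - ((u - v) - (-1) * m i)" by simp
    ultimately show ?thesis by (metis dvd_minus_iff insertCI mult_1)
  qed
  obtain s t w where s: "s \<in> {1, -1}" "t \<in> {1, -1}" "w \<in> {1, -1::int}"
    "N dvd (x - y) - s * m i" "N dvd (y - z) - t * m i" "N dvd (x - z) - w * m i"
    using pm assms(2-4) by metis
  have "N dvd ((x - z) - w * m i) - (((x - y) - s * m i) + ((y - z) - t * m i))"
    by (intro dvd_diff dvd_add s)
  also have "\<dots> = (s + t - w) * m i" by (simp add: algebra_simps)
  finally have dv: "N dvd (s + t - w) * m i" .
  have "\<not> N dvd m i" "\<not> N dvd 3 * m i"
    using val_neq_0[OF i, of 1] val_neq_0[OF i, of 3] d by (auto simp: val_def dvd_eq_mod_eq_0)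
  moreover have "N dvd - m i \<longleftrightarrow> N dvd m i" "N dvd - (3 * m i) \<longleftrightarrow> N dvd 3 * m i" by simp_all
  ultimately show False using s(1-3) dv by auto
qed

text \<open>Each edge changes either the row or the column. Radial and orbit edges cannot be mixed
  in a triangle, and three radial ones contradict the parity of rows, so a triangle lies in one
  orbit row.\<close>

lemma no_adj_triangle:
  assumes "adj u v" "adj v w" "adj u w" "u \<noteq> v" "v \<noteq> w" "u \<noteq> w"
  shows False
proof -
  obtain r x r' y r'' z where eq: "u = (r, x)" "v = (r', y)" "w = (r'', z)" by (meson surj_pair)
  have *: "p = q \<and> (e = Suc h \<or> h = Suc e) \<or>
      e = h \<and> p \<noteq> q \<and> (\<exists>i\<le>k. e = ctr i \<and> ((p - q) mod N = val (i, 1) \<or> (q - p) mod N = val (i, 1)))"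
    if "adj (e, p) (h, q)" "(e, p) \<noteq> (h, q)" for e p h q
    using that by (auto simp: adj_def)
  note a = *[OF assms(1,4)[unfolded eq]] *[OF assms(2,5)[unfolded eq]] *[OF assms(3,6)[unfolded eq]]
  have "x = y \<and> (r = Suc r' \<or> r' = Suc r) \<or> r = r' \<and> x \<noteq> y"
    "y = z \<and> (r' = Suc r'' \<or> r'' = Suc r') \<or> r' = r'' \<and> y \<noteq> z"
    "x = z \<and> (r = Suc r'' \<or> r'' = Suc r) \<or> r = r'' \<and> x \<noteq> z"
    using a by blast+
  then have rows: "r = r'" "r' = r''" by presburger+
  obtain i1 i2 i3 where i: "i1 \<le> k" "i2 \<le> k" "i3 \<le> k" "r = ctr i1" "r = ctr i2" "r = ctr i3"
    "(x - y) mod N = val (i1, 1) \<or> (y - x) mod N = val (i1, 1)"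
    "(y - z) mod N = val (i2, 1) \<or> (z - y) mod N = val (i2, 1)"
    "(x - z) mod N = val (i3, 1) \<or> (z - x) mod N = val (i3, 1)"
    using a rows by auto
  have "i2 = i1" "i3 = i1" using i(4-6) ctr_inj by metis+
  then show False using no_orbit_triangle[OF i(1)] i(7-9) by blast
qed


section \<open>The complex of a deck\<close>

abbreviation G :: "(nat \<times> int) graph" where "G \<equiv> graphG n d k m"

abbreviation DT :: "int \<Rightarrow> (nat \<times> int) graph" where "DT \<equiv> deck_subgraph n d k m \<sigma> \<tau>"

lemma verts_G: "verts G = {..ctr k} \<times> Zmod n"
proof -
  have "vtx n r l = (r, l)" if "l \<in> Zmod n" for r l
    using Zmod_mod[OF that] by (simp add: vtx_def)
  then have "(\<lambda>(r, l). vtx n r l) ` ({..ctr k} \<times> Zmod n) = (\<lambda>u. u) ` ({..ctr k} \<times> Zmod n)"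
    by (intro image_cong) auto
  moreover have "verts G = (\<lambda>(r, l). vtx n r l) ` ({..ctr k} \<times> Zmod n)"
    unfolding verts_def graphG_def fst_conv ctr_def by force
  ultimately show ?thesis by simp
qed

lemma translate_eq_val_iff:
  assumes "x \<in> Zmod n"
  shows "(x - j) mod N = val (i, l) \<longleftrightarrow> x = (j + int l * m i) mod N"
proof
  assume "(x - j) mod N = val (i, l)"
  then have "(x - j + j) mod N = (int l * m i + j) mod N"
    unfolding val_def using mod_add_cong[of "x - j" N "int l * m i" j j] by simp
  then show "x = (j + int l * m i) mod N" using Zmod_mod[OF assms] by (simp add: add.commute)
next
  assume "x = (j + int l * m i) mod N"
  then show "(x - j) mod N = val (i, l)" by (simp add: val_def mod_diff_left_eq)
qed

text \<open>The start \<open>l = 0\<close> of an orbit path lies on the radial path, which accounts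
  for offset 0. For \<open>l \<ge> 1\<close>, the inward and the outward path from one orbit vertex
  together fill the rows of the label \<open>(i, l)\<close>.\<close>

lemma mem_verts_DT:
  assumes u: "u \<in> verts G" and j: "j \<in> Zmod n"
  shows "u \<in> verts (DT j) \<longleftrightarrow> j \<in> Hat u"
proof -
  obtain r x where ux: "u = (r, x)" by (cases u)
  have r: "r \<le> ctr k" and x: "x \<in> Zmod n" using u by (auto simp only: ux verts_G mem_Sigma_iff atMost_iff)
  have "u \<in> verts (DT j) \<longleftrightarrow>
      (\<exists>i l. i \<le> k \<and> l \<le> d + 1 \<and> r = ctr i \<and> x = (j + int l * m i) mod N) \<or> x = j mod N \<or>
      (\<exists>i l s. i < k \<and> 1 \<le> l \<and> l \<le> d + 1 \<and> s \<le> \<tau> (i + 1) (l - 1) \<and> r = ctr i + s \<and>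
        x = (j + int l * m i) mod N) \<or>
      (\<exists>i l s. 1 \<le> i \<and> i \<le> k \<and> 1 \<le> l \<and> l \<le> d + 1 \<and> s \<le> \<sigma> i (l - 1) \<and> r = ctr i - s \<and>
        x = (j + int l * m i) mod N)" (is "_ \<longleftrightarrow> ?A \<or> ?B \<or> ?C \<or> ?D")
  proof -
    have a: "u \<in> (\<Union>i\<in>{0..k}. orbit_path_verts n d m j i) \<longleftrightarrow> ?A"
      unfolding ux orbit_path_verts_def vtx_def ctr_def by auto
    have b: "u \<in> radial_path_verts n d k j \<longleftrightarrow> ?B"
      using r unfolding ux radial_path_verts_def vtx_def ctr_def by auto
    have c: "u \<in> (\<Union>i\<in>{..<k}. \<Union>l\<in>{1..d+1}. outward_path_verts n d m \<tau> j i l) \<longleftrightarrow> ?C"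
      unfolding ux outward_path_verts_def vtx_def ctr_def by fastforce
    have e: "u \<in> (\<Union>i\<in>{1..k}. \<Union>l\<in>{1..d+1}. inward_path_verts n d m \<sigma> j i l) \<longleftrightarrow> ?D"
      unfolding ux inward_path_verts_def vtx_def ctr_def by fastforce
    have eqv: "verts (DT j) = verts G \<inter> ((\<Union>i\<in>{0..k}. orbit_path_verts n d m j i)
        \<union> radial_path_verts n d k j
        \<union> (\<Union>i\<in>{..<k}. \<Union>l\<in>{1..d+1}. outward_path_verts n d m \<tau> j i l)
        \<union> (\<Union>i\<in>{1..k}. \<Union>l\<in>{1..d+1}. inward_path_verts n d m \<sigma> j i l))"
      unfolding deck_subgraph_def induced_subgraph_def verts_def by simp
    show ?thesis
      unfolding eqv Int_iff Un_iff a b c e using u by (simp only: simp_thms disj_assoc)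
  qed
  also have "\<dots> \<longleftrightarrow> x = j mod N \<or> (\<exists>i l. (i, l) \<in> lab r \<and> x = (j + int l * m i) mod N)" (is "_ \<longleftrightarrow> _ \<or> ?E")
  proof -
    have A: "?A \<Longrightarrow> ?B \<or> ?E"
    proof -
      assume ?A
      then obtain i l where il: "i \<le> k" "l \<le> d + 1" "r = ctr i" "x = (j + int l * m i) mod N" by blast
      show ?thesis
      proof (cases "l = 0")
        case False
        then have "(i, l) \<in> lab r" using il by (simp add: lab_def)
        then show ?thesis using il by blast
      qed (use il in simp)
    qed
    have C: "?C \<Longrightarrow> ?E"
    proof -
      assume ?C
      then obtain i l s where il: "i < k" "1 \<le> l" "l \<le> d + 1" "s \<le> \<tau> (i + 1) (l - 1)" "r = ctr i + s"
        "x = (j + int l * m i) mod N" by blast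
      then have "(i, l) \<in> lab r" by (simp add: lab_def up_def)
      then show ?thesis using il by blast
    qed
    have D: "?D \<Longrightarrow> ?E"
    proof -
      assume ?D
      then obtain i l s where il: "1 \<le> i" "i \<le> k" "1 \<le> l" "l \<le> d + 1" "s \<le> \<sigma> i (l - 1)" "r = ctr i - s"
        "x = (j + int l * m i) mod N" by blast
      then have "ctr i \<le> r + \<sigma> i (l - 1)" "r \<le> ctr i + up i l" by linarith+
      then have "(i, l) \<in> lab r" using il by (simp add: lab_def dn_def)
      then show ?thesis using il by blast
    qed
    have E: "?E \<Longrightarrow> ?A \<or> ?C \<or> ?D"
    proof -
      assume ?E
      then obtain i l where il: "(i, l) \<in> lab r" "x = (j + int l * m i) mod N" by blast
      then have b: "i \<le> k" "1 \<le> l" "l \<le> d + 1" "ctr i \<le> r + dn i l" "r \<le> ctr i + up i l"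
        by (auto simp: lab_def)
      consider "r = ctr i" | "ctr i < r" | "r < ctr i" by linarith
      then show ?thesis
      proof cases
        case 1
        then show ?thesis using b il by blast
      next
        case 2
        then have "i < k" using b(5) by (auto simp: up_def split: if_splits)
        then have ?C using 2 b il
          by (intro exI[of _ i] exI[of _ l] exI[of _ "r - ctr i"]) (auto simp: up_def)
        then show ?thesis by blast
      next
        case 3
        then have "1 \<le> i" by (cases i) auto
        then have ?D using 3 b il
          by (intro exI[of _ i] exI[of _ l] exI[of _ "ctr i - r"]) (auto simp: dn_def)
        then show ?thesis by blast
      qed
    qed
    show ?thesis using A C D E by blast
  qed
  also have "\<dots> \<longleftrightarrow> (x - j) mod N \<in> offs r"
  proof -
    have "(x - j) mod N = 0 \<longleftrightarrow> x = j mod N"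
      using translate_eq_val_iff[OF x, of j 0 0] by simp
    moreover have "(x - j) mod N \<in> val ` lab r \<longleftrightarrow> ?E"
      using translate_eq_val_iff[OF x, of j] by (auto simp: image_iff)
    ultimately show ?thesis by (simp add: offs_def)
  qed
  finally show ?thesis using j by (simp add: Hat_def ux)
qed

lemma hat_eq_Hat: "u \<in> verts G \<Longrightarrow> hat (Zmod n) DT u = Hat u"
  unfolding hat_def using mem_verts_DT[of u] by (auto simp: Hat_def)

lemma card_Hat_verts: "u \<in> verts G \<Longrightarrow> card (Hat u) = d + 2"
  using card_Hat by (cases u) (auto simp: verts_G)

lemma Hat_subset: "Hat u \<subseteq> Zmod n" unfolding Hat_def by blast

lemma Hat_ridge:
  assumes "u \<in> verts G" "v \<in> verts G" "u \<noteq> v" "d + 1 \<le> card (Hat u \<inter> Hat v)"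
  shows "adj u v"
  using assms Hat_adj[of "fst u" "fst v" "snd u" "snd v"] by (simp add: verts_G mem_Times_iff)

lemma Hat_triple:
  assumes "u \<in> verts G" "v \<in> verts G" "w \<in> verts G" "u \<noteq> v" "v \<noteq> w" "u \<noteq> w"
  shows "card (Hat u \<inter> Hat v \<inter> Hat w) < d + 1"
proof (rule ccontr)
  assume *: "\<not> ?thesis"
  have "d + 1 \<le> card (Hat p \<inter> Hat q)" if "Hat u \<inter> Hat v \<inter> Hat w \<subseteq> Hat p \<inter> Hat q" for p q
    using card_mono[OF _ that] finite_Hat * by fastforce
  then have "adj u v" "adj v w" "adj u w"
    using assms by (intro Hat_ridge; blast)+
  then show False using no_adj_triangle assms(4-6) by blast
qed

text \<open>This uses that every residue is a difference of a pair in \<open>\<Omega>\<close>. Both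
  members of such a pair are offsets of a common row, and a suitable column then contains both
  elements in its hat.\<close>

lemma Hat_neighbour:
  assumes "j \<in> Zmod n" "j' \<in> Zmod n"
  obtains u where "u \<in> verts G" "j \<in> Hat u" "j' \<in> Hat u"
proof -
  have "(j' - j) mod N \<in> diff ` \<Omega>" unfolding diff_surj by simp
  then obtain p where p: "p \<in> \<Omega>" "(j' - j) mod N = diff p" by blast
  obtain x y where xy: "p = (x, y)" by (cases p)
  have ex: "\<exists>r\<le>ctr k. val a \<in> offs r \<and> val b \<in> offs r" if ab: "(a, b) \<in> \<Omega>\<^sub>1 \<union> \<Omega>\<^sub>2" for a b
  proof -
    consider "(a, b) \<in> \<Omega>\<^sub>1" | "(a, b) \<in> \<Omega>\<^sub>2" using ab by blast
    then show ?thesis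
    proof cases
      case 1
      then obtain i l where il: "a = (i, l)" "b = (i, 0)" "i \<le> k" "1 \<le> l" "l \<le> d + 1"
        unfolding \<Omega>\<^sub>1_def by blast
      then have "a \<in> lab (ctr i)" by (simp add: lab_def)
      then show ?thesis using il ctr_mono[of i k] by (intro exI[of _ "ctr i"]) (simp add: offs_def)
    next
      case 2
      then obtain i l l' where il: "a = (i, l)" "b = (i + 1, l')" "i < k" "1 \<le> l" "l \<le> d + 1" "1 \<le> l'"
        "l' \<le> d + 1" "d + 1 \<le> \<sigma> (i + 1) (l' - 1) + \<tau> (i + 1) (l - 1)"
        unfolding \<Omega>\<^sub>2_def by blast
      \<comment> \<open>The row in which the outward path ends; the inequality of
        \<open>\<Omega>\<^sub>2\<close> says that the inward path from the next orbit gets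
        there.\<close>
      define r where "r = ctr i + up i l"
      have "a \<in> lab r" using il by (simp add: lab_def r_def)
      moreover have "b \<in> lab r"
        using il up_le[of l i] by (simp add: lab_def r_def ctr_Suc dn_def) (simp add: up_def)
      moreover have "r \<le> ctr k" using ctr_up_le[of l i] il by (simp add: r_def)
      ultimately show ?thesis by (auto simp: offs_def)
    qed
  qed
  have "\<exists>r\<le>ctr k. val x \<in> offs r \<and> val y \<in> offs r"
  proof -
    consider "p = ((0, 0), (0, 0))" | "p \<in> \<Omega>\<^sub>1 \<union> \<Omega>\<^sub>2" | "prod.swap p \<in> \<Omega>\<^sub>1 \<union> \<Omega>\<^sub>2"
      using p(1) unfolding \<Omega>_def by force
    then show ?thesis
    proof cases
      case 1
      then show ?thesis using xy by (intro exI[of _ 0]) (simp add: offs_def)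
    next
      case 2
      then show ?thesis using ex[of x y] xy by simp
    next
      case 3
      then have "(y, x) \<in> \<Omega>\<^sub>1 \<union> \<Omega>\<^sub>2" using xy by simp
      from ex[OF this] show ?thesis by blast
    qed
  qed
  then obtain r where r: "r \<le> ctr k" "val x \<in> offs r" "val y \<in> offs r" by blast
  define z where "z = (j + val x) mod N"
  have zj: "(z - j) mod N = val x"
    using Zmod_mod[OF val_in_Zmod[of x]] by (simp add: z_def mod_diff_left_eq)
  have "(z - j') mod N = ((z - j) mod N - (j' - j) mod N) mod N"
    by (simp add: mod_diff_eq)
  also have "\<dots> = val y"
    using Zmod_mod[OF val_in_Zmod[of y]] unfolding zj p(2) xy diff_Pair by (simp add: mod_diff_right_eq)
  finally have "(z - j') mod N = val y" .
  then have "j \<in> Hat (r, z)" "j' \<in> Hat (r, z)" using zj r assms by (auto simp: Hat_def)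
  moreover have "(r, z) \<in> verts G" using r(1) mod_in_Zmod unfolding verts_G z_def by blast
  ultimately show ?thesis using that by blast
qed

section \<open>The star of a vertex: its size and connectedness\<close>

lemma card_star: "j \<in> Zmod n \<Longrightarrow> card {u \<in> verts G. j \<in> Hat u} = (d + 2) * (ctr k + 1)"
proof -
  assume j: "j \<in> Zmod n"
  have "{u \<in> verts G. j \<in> Hat u} = (SIGMA r:{..ctr k}. {x \<in> Zmod n. (x - j) mod N \<in> offs r})"
    using j by (auto simp: verts_G Hat_def simp del: partial_object.simps)
  moreover have "card {x \<in> Zmod n. (x - j) mod N \<in> offs r} = d + 2" if "r \<le> ctr k" for r
    using card_translate[OF offs_subset] card_offs[OF that] by simp
  ultimately show ?thesis using finite_Zmod by simp
qed

lemma card_Hat_Int_Suc: "r < ctr k \<Longrightarrow> d + 1 \<le> card (Hat (r, x) \<inter> Hat (Suc r, x))"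
  using card_Hat_Int_same[of r x "Suc r"] card_lab_Suc[of r] by simp

lemma offs_ctr: "i \<le> k \<Longrightarrow> l \<le> d + 1 \<Longrightarrow> val (i, l) \<in> offs (ctr i)"
  by (cases "l = 0") (auto simp: offs_def lab_ctr)

text \<open>A step by \<open>m i\<close> carries the multiples 0 to d onto 1 to d + 1, and all of
  these are offsets of the orbit row.\<close>

lemma card_Hat_Int_orbit:
  assumes "i \<le> k"
  shows "d + 1 \<le> card (Hat (ctr i, x mod N) \<inter> Hat (ctr i, (x + m i) mod N))"
proof -
  define B where "B = (\<lambda>l. val (i, l)) ` {..d}"
  have B: "B \<subseteq> Zmod n" using val_in_Zmod unfolding B_def by blast
  have cardB: "card B = d + 1"
    unfolding B_def by (subst card_image) (auto intro!: inj_onI dest: val_same_inj[OF assms, rotated 2])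
  have sub: "{j \<in> Zmod n. (x - j) mod N \<in> B} \<subseteq> Hat (ctr i, x mod N) \<inter> Hat (ctr i, (x + m i) mod N)"
  proof
    fix j assume "j \<in> {j \<in> Zmod n. (x - j) mod N \<in> B}"
    then obtain l where l: "j \<in> Zmod n" "(x - j) mod N = val (i, l)" "l \<le> d" by (auto simp: B_def)
    have "(x + m i - j) mod N = ((x - j) + m i) mod N" by (simp add: algebra_simps)
    also have "\<dots> = ((x - j) mod N + m i) mod N" by (simp add: mod_add_left_eq)
    also have "\<dots> = val (i, Suc l)"
      unfolding l(2) val_def fst_conv snd_conv mod_add_left_eq by (simp add: algebra_simps)
    finally show "j \<in> Hat (ctr i, x mod N) \<inter> Hat (ctr i, (x + m i) mod N)"
      using l offs_ctr[OF assms, of l] offs_ctr[OF assms, of "Suc l"]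
      by (simp add: Hat_def mod_diff_left_eq)
  qed
  have "card {j \<in> Zmod n. (x - j) mod N \<in> B} \<le> card (Hat (ctr i, x mod N) \<inter> Hat (ctr i, (x + m i) mod N))"
    using sub finite_Hat by (intro card_mono) blast+
  then show ?thesis using card_reflect[OF B, of x] cardB by linarith
qed

text \<open>The root \<open>(0, j)\<close> starts the radial path. A vertex of the star is reached
  by the radial path to an orbit row, then the orbit path, then an outward or inward path; all steps
  stay in the star and are edges whose hats share d + 1 elements.\<close>

lemma star_connected:
  assumes j: "j \<in> Zmod n" and u: "u \<in> verts G" "j \<in> Hat u"
  defines "S \<equiv> {u \<in> verts G. j \<in> Hat u}"
  shows "((0, j), u) \<in> {(u, v). u \<in> S \<and> v \<in> S \<and> d + 1 \<le> card (Hat u \<inter> Hat v)}\<^sup>*" (is "_ \<in> ?R\<^sup>*")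
proof -
  have S: "(r, x) \<in> S \<longleftrightarrow> r \<le> ctr k \<and> x \<in> Zmod n \<and> (x - j) mod N \<in> offs r" for r x
    using j by (auto simp: S_def verts_G Hat_def simp del: partial_object.simps)
  have radial: "((0, j), (r, j)) \<in> ?R\<^sup>*" if "r \<le> ctr k" for r
    using that
  proof (induction r)
    case (Suc r)
    have "((r, j), (Suc r, j)) \<in> ?R"
      using Suc.prems j card_Hat_Int_Suc[of r j] by (auto simp: S offs_def)
    then show ?case using Suc by (simp add: rtrancl.rtrancl_into_rtrancl)
  qed simp
  define y where "y i l = (j + int l * m i) mod N" for i l
  have y: "y i l \<in> Zmod n" "(y i l - j) mod N = val (i, l)" for i l
    using translate_eq_val_iff[of "y i l" j i l] mod_in_Zmod unfolding y_def by blast+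
  have orbit: "((0, j), (ctr i, y i l)) \<in> ?R\<^sup>*" if "i \<le> k" "l \<le> d + 1" for i l
    using that
  proof (induction l)
    case 0
    then show ?case using radial[of "ctr i"] ctr_mono[of i k] Zmod_mod[OF j] by (simp add: y_def)
  next
    case (Suc l)
    have "(ctr i, y i l) \<in> S" "(ctr i, y i (Suc l)) \<in> S"
      using Suc.prems ctr_mono[of i k] y offs_ctr[of i l] offs_ctr[of i "Suc l"] by (simp_all only: S)
    moreover have "y i (Suc l) = (j + int l * m i + m i) mod N" by (simp add: y_def algebra_simps)
    then have "d + 1 \<le> card (Hat (ctr i, y i l) \<inter> Hat (ctr i, y i (Suc l)))"
      using card_Hat_Int_orbit[of i "j + int l * m i"] Suc.prems by (simp add: y_def)
    ultimately have "((ctr i, y i l), (ctr i, y i (Suc l))) \<in> ?R" by blast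
    then show ?case using Suc by (simp add: rtrancl.rtrancl_into_rtrancl)
  qed
  have in_S: "(r, y i l) \<in> S" if "(i, l) \<in> lab r" "r \<le> ctr k" for r i l
    using that y by (auto simp only: S offs_def)
  have outward: "((0, j), (ctr i + s, y i l)) \<in> ?R\<^sup>*"
    if "i \<le> k" "1 \<le> l" "l \<le> d + 1" "s \<le> up i l" for i l s
    using that
  proof (induction s)
    case 0
    then show ?case using orbit by simp
  next
    case (Suc s)
    have le: "ctr i + Suc s \<le> ctr k" using ctr_up_le[of l i] Suc.prems by simp
    have "(i, l) \<in> lab (ctr i + s)" "(i, l) \<in> lab (ctr i + Suc s)"
      using Suc.prems by (auto simp: lab_def)
    then have "((ctr i + s, y i l), (ctr i + Suc s, y i l)) \<in> ?R"
      using in_S le card_Hat_Int_Suc[of "ctr i + s" "y i l"] by auto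
    then show ?case using Suc by (simp add: rtrancl.rtrancl_into_rtrancl)
  qed
  have inward: "((0, j), (ctr i - s, y i l)) \<in> ?R\<^sup>*"
    if "i \<le> k" "1 \<le> l" "l \<le> d + 1" "s \<le> dn i l" for i l s
    using that
  proof (induction s)
    case 0
    then show ?case using orbit by simp
  next
    case (Suc s)
    have i: "1 \<le> i" using Suc.prems by (auto simp: dn_def split: if_splits)
    have "Suc s \<le> ctr i" using dn_le[of l i] Suc.prems ctr_less[of 0 i] i by simp
    then have eq: "ctr i - s = Suc (ctr i - Suc s)" and lt: "ctr i - Suc s < ctr k"
      using ctr_mono[of i k] Suc.prems by linarith+
    have "(i, l) \<in> lab (ctr i - s)" "(i, l) \<in> lab (ctr i - Suc s)"
      using Suc.prems by (auto simp: lab_def)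
    then have "((ctr i - s, y i l), (ctr i - Suc s, y i l)) \<in> ?R"
      using in_S lt eq card_Hat_Int_Suc[of "ctr i - Suc s" "y i l"] by (auto simp: Int_commute)
    then show ?case using Suc by (simp add: rtrancl.rtrancl_into_rtrancl)
  qed
  obtain r x where ux: "u = (r, x)" by (cases u)
  then have rx: "r \<le> ctr k" "x \<in> Zmod n" "(x - j) mod N \<in> offs r" using S[of r x] u by (auto simp only: S_def)
  then consider "(x - j) mod N = 0" | i l where "(i, l) \<in> lab r" "(x - j) mod N = val (i, l)"
    by (auto simp: offs_def)
  then show ?thesis
  proof cases
    case 1
    then have "x = j" using translate_inj[OF rx(2) j, of j] by simp
    then show ?thesis using radial[OF rx(1)] ux by simp
  next
    case 2
    have xy: "x = y i l" using translate_eq_val_iff[OF rx(2)] 2(2) by (simp add: y_def)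
    have b: "i \<le> k" "1 \<le> l" "l \<le> d + 1" "ctr i \<le> r + dn i l" "r \<le> ctr i + up i l"
      using 2(1) by (auto simp: lab_def)
    show ?thesis
    proof (cases "ctr i \<le> r")
      case True
      then show ?thesis using outward[OF b(1-3), of "r - ctr i"] b ux xy by simp
    next
      case False
      then show ?thesis using inward[OF b(1-3), of "ctr i - r"] b ux xy by simp
    qed
  qed
qed

section \<open>Vertex links and facets of the complex\<close>

lemma graph_complex_eq: "graph_complex G (Zmod n) DT = {f. \<exists>u\<in>verts G. f \<subseteq> Hat u}"
  unfolding graph_complex_def using hat_eq_Hat by auto

lemma stacked_link:
  assumes j: "j \<in> Zmod n"
  shows "stacked_ball d (link (graph_complex G (Zmod n) DT) j)"
proof -
  define S where "S = {u \<in> verts G. j \<in> Hat u}"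
  define h where "h u = Hat u - {j}" for u
  have link: "link (graph_complex G (Zmod n) DT) j = {f. \<exists>u\<in>S. f \<subseteq> h u}"
    unfolding link_def graph_complex_eq S_def h_def by blast
  have card_h: "d \<le> card (h u \<inter> h v)" if "d + 1 \<le> card (Hat u \<inter> Hat v)" for u v
  proof -
    have "h u \<inter> h v = (Hat u \<inter> Hat v) - {j}" by (auto simp: h_def)
    then show ?thesis using that diff_card_le_card_Diff[of "{j}" "Hat u \<inter> Hat v"] by simp
  qed
  have "stacked_complex d {f. \<exists>u\<in>S. f \<subseteq> h u}"
  proof (rule stacked_complex_connected_family)
    show "finite S" unfolding S_def verts_G using finite_Zmod by simp
    have "0 \<le> ctr k" "(0::int) \<in> offs 0" by (simp_all add: offs_def)
    then show "(0, j) \<in> S" using j by (simp add: S_def verts_G Hat_def)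
    show "finite (h u)" for u using finite_Hat by (simp add: h_def)
    show "card (h u) = Suc d" if "u \<in> S" for u
      using that card_Hat_verts[of u] finite_Hat by (simp add: S_def h_def)
    show "((0, j), u) \<in> {(u, v). u \<in> S \<and> v \<in> S \<and> d \<le> card (h u \<inter> h v)}\<^sup>*" if "u \<in> S" for u
    proof -
      have "((0, j), u) \<in> {(u, v). u \<in> S \<and> v \<in> S \<and> d + 1 \<le> card (Hat u \<inter> Hat v)}\<^sup>*"
        using star_connected[OF j, of u] that by (simp add: S_def)
      moreover have "{(u, v). u \<in> S \<and> v \<in> S \<and> d + 1 \<le> card (Hat u \<inter> Hat v)}
          \<subseteq> {(u, v). u \<in> S \<and> v \<in> S \<and> d \<le> card (h u \<inter> h v)}"
        using card_h by blast
      ultimately show ?thesis using rtrancl_mono by blast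
    qed
    \<comment> \<open>Neighbourliness: every other residue is a vertex of the link.\<close>
    have "Zmod n - {j} \<subseteq> \<Union>(h ` S)"
    proof
      fix j' assume j': "j' \<in> Zmod n - {j}"
      then obtain u where "u \<in> verts G" "j \<in> Hat u" "j' \<in> Hat u" using Hat_neighbour[OF j, of j'] by blast
      then show "j' \<in> \<Union>(h ` S)" using j' unfolding S_def h_def by blast
    qed
    then have "card (Zmod n - {j}) \<le> card (\<Union>(h ` S))"
      using \<open>finite S\<close> finite_Hat by (intro card_mono) (auto simp: h_def)
    moreover have "card (Zmod n - {j}) = n - 1"
      using j finite_Zmod by (simp add: Zmod_eq)
    moreover have "card S + d = n - 1"
      \<comment> \<open>The second role of \<open>n\<close>: (d+2)((d+1)k+1) + d = n - 1.\<close>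
      unfolding S_def card_star[OF j] by (simp add: n ctr_def algebra_simps)
    ultimately show "card S + d \<le> card (\<Union>(h ` S))" by simp
    fix u v w assume uvw: "u \<in> S" "v \<in> S" "w \<in> S" "u \<noteq> v" "v \<noteq> w" "u \<noteq> w"
    have "card (Hat u \<inter> Hat v \<inter> Hat w) < d + 1"
      using uvw by (intro Hat_triple) (auto simp: S_def)
    moreover have "h u \<inter> h v \<inter> h w = Hat u \<inter> Hat v \<inter> Hat w - {j}" "j \<in> Hat u \<inter> Hat v \<inter> Hat w"
      using uvw by (auto simp: h_def S_def)
    ultimately show "card (h u \<inter> h v \<inter> h w) < d"
      using finite_Hat card_Suc_Diff1[of "Hat u \<inter> Hat v \<inter> Hat w" j] by simp
  qed
  then show ?thesis unfolding link using d by (intro stacked_complex_stacked_ball) auto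
qed

text \<open>All hats have d + 2 elements, so none is properly contained in another.\<close>

lemma facets_graph_complex: "facets (graph_complex G (Zmod n) DT) = Hat ` verts G"
proof
  show "facets (graph_complex G (Zmod n) DT) \<subseteq> Hat ` verts G"
    unfolding facets_def graph_complex_eq by blast
  have "g = Hat u" if "u \<in> verts G" "v \<in> verts G" "Hat u \<subseteq> g" "g \<subseteq> Hat v" for u v g
  proof -
    have "Hat u = Hat v"
      using that card_Hat_verts finite_Hat by (intro card_subset_eq) auto
    then show ?thesis using that by blast
  qed
  then show "Hat ` verts G \<subseteq> facets (graph_complex G (Zmod n) DT)"
    unfolding facets_def graph_complex_eq by blast
qed

lemma graph_complex_properties:
  defines "K \<equiv> graph_complex G (Zmod n) DT"
  shows "pure K \<and> facets K = hat (Zmod n) DT ` verts G \<and> neighbourly K \<and> K \<in> Kbar (d+1)"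
proof (intro conjI)
  have K: "K = {f. \<exists>u\<in>verts G. f \<subseteq> Hat u}" unfolding K_def by (rule graph_complex_eq)
  have facets: "facets K = Hat ` verts G" unfolding K_def by (rule facets_graph_complex)
  then show "facets K = hat (Zmod n) DT ` verts G" using hat_eq_Hat by simp
  show "pure K" unfolding pure_def facets face_dim_def using card_Hat_verts by simp
  have vert: "j \<in> Zmod n" if "j \<in> vertices K" for j
    using that Hat_subset unfolding vertices_def K by blast
  show "neighbourly K"
    unfolding neighbourly_def
  proof (intro ballI impI)
    fix j j' assume "j \<in> vertices K" "j' \<in> vertices K"
    then obtain u where "u \<in> verts G" "j \<in> Hat u" "j' \<in> Hat u" using Hat_neighbour vert by blast
    then show "{j, j'} \<in> K" unfolding K by blast
  qed
  have "verts G \<noteq> {}" using mod_in_Zmod[of 0] unfolding verts_G by blast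
  then have "simplicial_complex K"
    unfolding simplicial_complex_def K using finite_Hat finite_subset by blast
  moreover have "stacked_ball d (link K j)" if "j \<in> vertices K" for j
    unfolding K_def by (rule stacked_link[OF vert[OF that]])
  ultimately show "K \<in> Kbar (d+1)" by (simp add: Kbar_def)
qed

end

theorem theorem3p4:
  fixes d k n :: nat
    and m :: "nat \<Rightarrow> int"
    and \<sigma> \<tau> :: "nat \<Rightarrow> nat \<Rightarrow> nat"
    and G :: "(nat \<times> int) graph"
    and DT :: "int \<Rightarrow> (nat \<times> int) graph"
    and K :: "int set set"
  assumes "d \<ge> 2"
    and "n = (d+1) * ((d+2) * k + 2) + 1"
    and "\<And>i. i \<le> k \<Longrightarrow> m i \<in> Units (residue_ring (int n))"
    and "deck d k \<sigma> \<tau>"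
    and "deck_span n d k m \<sigma> \<tau> = Zmod n"
    and "\<And>i t. 2 \<le> i \<Longrightarrow> i \<le> k \<Longrightarrow> t \<le> d - 1 \<Longrightarrow> \<tau> i t + \<sigma> (i-1) t \<ge> 1"
    and "\<And>i. 1 \<le> i \<Longrightarrow> i \<le> k \<Longrightarrow> \<sigma> i d \<ge> 1 \<and> \<tau> i d \<ge> 1"
  defines "G \<equiv> graphG n d k m"
    and "DT \<equiv> deck_subgraph n d k m \<sigma> \<tau>"
    and "K \<equiv> graph_complex G (Zmod n) DT"
  shows "pure K \<and> facets K = hat (Zmod n) DT ` verts G \<and>
         neighbourly K \<and> K \<in> Kbar (d+1)"
proof -
  interpret deck_family d k n m \<sigma> \<tau>
    by unfold_locales (fact assms(1,2,4-7))+
  show ?thesis unfolding K_def G_def DT_def by (rule graph_complex_properties)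
qed

end
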